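(* Let $\kappa,\lambda\in(0,1)$ with $\kappa^2+\lambda^2=1$, and let $\theta\in(0,\pi/6)$ be the angle with $\lambda=\cos 3\theta$ (equivalently $\kappa=\sin 3\theta$). Let $x_1$ denote the unique zero in $(0,1)$ of the cubic $g(x)=x^3+3x^2-4\lambda^2$. Then the positive critical value of $\mathrm{dn}_3$ (among its values at the nonzero half-periods) is $$\mathrm{dn}_3(K)=x_1=4\cos^2\theta-3=2\cos 2\theta-1.$$
   Context: $F(a,b;c;z)$ is the Gauss hypergeometric function ${}_2F_1$. Let $\phi$ be the analytic local inverse near $0$, with $\phi(0)=0$, of $f(T)=\int_0^T F(\tfrac13,\tfrac23;\tfrac12;\kappa^2\sin^2 t)\,dt$. The function $\mathrm{dn}_3$ is defined near $0$ by $\mathrm{dn}_3=\phi'$; it extends (uniquely) to an elliptic function on $\mathbb{C}$, also denoted $\mathrm{dn}_3$, namely $$\mathrm{dn}_3=1-\frac{\frac49\kappa^2}{\frac13+\wp},$$ where $\wp$ is the Weierstrass function (satisfying $(\wp')^2=4\wp^3-g_2\wp-g_3$, with a double pole at $0$) with invariants $g_2=\frac{4}{27}(1+8\lambda^2)$ and $g_3=\frac{8}{729}(8\lambda^4+20\lambda^2-1)$. The invariants are real and $g_2^3-27g_3^2>0$, so the period lattice of $\wp$ (which is also that of $\mathrm{dn}_3$) is rectangular: it is $\{2mK+2n\,\mathrm{i}K' : m,n\in\mathbb{Z}\}$ with $K>0$ and $K'>0$, which defines $K$ and $K'$. A critical value of $\mathrm{dn}_3$ is a value assumed at a point where $\mathrm{dn}_3'=0$.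 These points are those congruent modulo periods to $0$ (where the value is $1$) or to one of the nonzero half-periods $K$, $K+\mathrm{i}K'$, $\mathrm{i}K'$; the values at the latter three are the three zeros of $g$, exactly one of which is positive. *)

theory Defs
  imports "HOL-Complex_Analysis.Complex_Analysis"
begin

definition hyp2F1 :: "complex \<Rightarrow> complex \<Rightarrow> complex \<Rightarrow> complex \<Rightarrow> complex" where
  "hyp2F1 a b c z = eval_fps (fps_hypergeo [a, b] [c] 1) z"

(* The integral runs along the segment from 0 to T. It is only used for T near 0, where
   the argument of the hypergeometric series stays inside the unit disc. *)
definition dn3_integral :: "real \<Rightarrow> complex \<Rightarrow> complex" where
  "dn3_integral \<kappa> T = contour_integral (linepath 0 T)
     (\<lambda>t. hyp2F1 (1/3) (2/3) (1/2) ((complex_of_real \<kappa>)\<^sup>2 * (sin t)\<^sup>2))"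

definition analytic_local_inverse_0 :: "(complex \<Rightarrow> complex) \<Rightarrow> (complex \<Rightarrow> complex) \<Rightarrow> bool" where
  "analytic_local_inverse_0 f \<phi> \<longleftrightarrow>
     \<phi> analytic_on {0} \<and> \<phi> 0 = 0 \<and>
     (\<forall>\<^sub>F u in nhds 0. f (\<phi> u) = u) \<and> (\<forall>\<^sub>F T in nhds 0. \<phi> (f T) = T)"

definition periods :: "(complex \<Rightarrow> complex) \<Rightarrow> complex set" where
  "periods f = {w. \<forall>z. f (z + w) = f z}"

(* Functions that are nicely meromorphic have no removable singularities and take the value
   0 at their poles, so that periodicity may be required at every point. The condition on
   the imaginary part says that the two periods are linearly independent over the reals. *)
definition elliptic_function :: "(complex \<Rightarrow> complex) \<Rightarrow> bool" where
  "elliptic_function f \<longleftrightarrow> f nicely_meromorphic_on UNIV \<and>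
     (\<exists>w1\<in>periods f. \<exists>w2\<in>periods f. Im (w1 / w2) \<noteq> 0)"

(* The differential equation determines a nonconstant solution up to translation of the argument;
   the double pole at 0 removes this freedom. *)
definition weierstrass_function :: "complex \<Rightarrow> complex \<Rightarrow> (complex \<Rightarrow> complex) \<Rightarrow> bool" where
  "weierstrass_function g2 g3 P \<longleftrightarrow> P nicely_meromorphic_on UNIV \<and>
     is_pole P 0 \<and> zorder P 0 = -2 \<and>
     (\<forall>z. \<not> is_pole P z \<longrightarrow> (deriv P z)\<^sup>2 = 4 * P z ^ 3 - g2 * P z - g3)"

definition dn3_g2 :: "real \<Rightarrow> real" where
  "dn3_g2 lam = 4 / 27 * (1 + 8 * lam\<^sup>2)"

definition dn3_g3 :: "real \<Rightarrow> real" where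
  "dn3_g3 lam = 8 / 729 * (8 * lam ^ 4 + 20 * lam\<^sup>2 - 1)"

definition rectangular_lattice :: "real \<Rightarrow> real \<Rightarrow> complex set" where
  "rectangular_lattice K K' =
     {2 * of_int m * of_real K + 2 * of_int n * (\<i> * of_real K') | m n :: int. True}"

definition dn3_cubic :: "real \<Rightarrow> real \<Rightarrow> real" where
  "dn3_cubic lam x = x ^ 3 + 3 * x\<^sup>2 - 4 * lam\<^sup>2"

(* A vanishing derivative in the sense of has_field_derivative includes differentiability,
   so poles do not count as critical points. *)
definition critical_values_at :: "(complex \<Rightarrow> complex) \<Rightarrow> complex set \<Rightarrow> complex set" where
  "critical_values_at f S = f ` {z \<in> S. (f has_field_derivative 0) (at z)}"

end

theory Submission
  imports Defs
begin

text \<open>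
  The closed form \<open>F(1/3, 2/3; 1/2; sin\<^sup>2 y) = cos (y/3) / cos y\<close> makes \<open>x = \<phi>'\<close> an algebraic function of
  \<open>sin \<phi>\<close>, and differentiating the algebraic relation yields \<open>9 x'\<^sup>2 = 4 (1 - x) g(x)\<close>. Hence
  \<open>(4/9) \<kappa>\<^sup>2 / (1 - x) - 1/3\<close> has a pole at \<open>0\<close> and satisfies the Weierstrass equation. Such a germ is unique,
  because its reciprocal \<open>y\<close> satisfies \<open>y'\<^sup>2 = 4 y - g\<^sub>2 y\<^sup>3 - g\<^sub>3 y\<^sup>4\<close> with \<open>y(0) = 0\<close>, whose derivative is
  a second-order equation without singularity. The same uniqueness shows that \<open>P\<close> is even,
  commutes with conjugation, and has its poles only at periods. So \<open>P'\<close> vanishes at the three half-periods, and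
  \<open>g\<close> vanishes at the values of \<open>dn\<^sub>3\<close> there. Along the segment from \<open>0\<close> to \<open>K\<close> the function \<open>P\<close> is real and
  starts at \<open>+\<infinity>\<close> and cannot cross the value that corresponds to \<open>x = 0\<close>, where the Weierstrass cubic
  is negative; therefore \<open>dn\<^sub>3 K\<close> is the positive zero of \<open>g\<close>.
\<close>

subsection \<open>Differential equations for formal power series\<close>

text \<open>Comparing coefficients of X^m expresses (m+1)(m+2) times coefficient m+2 of
  \<open>W\<close> through earlier ones, and this factor is invertible in characteristic 0.\<close>

lemma fps_linear_ode_zero:
  fixes W H :: "'a :: field_char_0 fps"
  assumes ode: "fps_deriv (fps_deriv W) = H * W" and "W $ 0 = 0" "W $ 1 = 0"
  shows "W = 0"
proof (rule fps_ext)
  fix n show "W $ n = 0 $ n"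
  proof (induction n rule: less_induct)
    case (less n)
    show ?case
    proof (cases "n < 2")
      case True
      then show ?thesis using assms by (auto simp: less_2_cases_iff)
    next
      case False
      then obtain m where m: "n = Suc (Suc m)"
        by (metis One_nat_def Suc_1 add_2_eq_Suc le_Suc_ex not_less)
      have "fps_deriv (fps_deriv W) $ m = (\<Sum>i=0..m. H $ i * W $ (m - i))"
        by (simp add: ode fps_mult_nth)
      also have "\<dots> = 0"
        using less m by (intro sum.neutral) auto
      finally have "of_nat (m + 1) * (of_nat (m + 2) * W $ n) = 0"
        by (simp add: m algebra_simps)
      moreover have "(of_nat (m + 1) :: 'a) \<noteq> 0" "(of_nat (m + 2) :: 'a) \<noteq> 0"
        by (metis of_nat_eq_0_iff add_is_0 zero_neq_one zero_neq_numeral)+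
      ultimately show ?thesis by simp
    qed
  qed
qed

text \<open>This is the equation of the reciprocal of a Weierstrass function. Differentiating it and
  cancelling Y' gives a second-order equation with both initial values 0. The difference of two
  solutions then satisfies a linear equation and vanishes. The zero series also solves the original
  equation; \<open>Y \<noteq> 0\<close> excludes it and makes the cancellation legitimate.\<close>

lemma fps_weierstrass_ode_unique:
  fixes Y Z :: "'a :: field_char_0 fps"
  assumes Y: "(fps_deriv Y)\<^sup>2 = 4 * Y - fps_const g2 * Y ^ 3 - fps_const g3 * Y ^ 4" "Y $ 0 = 0" "Y \<noteq> 0"
  assumes Z: "(fps_deriv Z)\<^sup>2 = 4 * Z - fps_const g2 * Z ^ 3 - fps_const g3 * Z ^ 4" "Z $ 0 = 0" "Z \<noteq> 0"
  shows "Y = Z"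
proof -
  have 1: "2 * fps_deriv (fps_deriv Y) = 4 - 3 * fps_const g2 * Y ^ 2 - 4 * fps_const g3 * Y ^ 3
      \<and> Y $ 1 = 0"
    if Y: "(fps_deriv Y)\<^sup>2 = 4 * Y - fps_const g2 * Y ^ 3 - fps_const g3 * Y ^ 4" "Y $ 0 = 0" "Y \<noteq> 0"
    for Y :: "'a fps"
  proof -
    have nz: "fps_deriv Y \<noteq> 0"
      using that by (metis fps_deriv_eq_0_iff fps_const_0_eq_0)
    have "fps_deriv ((fps_deriv Y)\<^sup>2) =
        fps_deriv (4 * Y - fps_const g2 * Y ^ 3 - fps_const g3 * Y ^ 4)"
      by (simp only: Y)
    hence "2 * (fps_deriv Y * fps_deriv (fps_deriv Y)) = 4 * fps_deriv Y
        - fps_const g2 * (3 * (Y * (Y * fps_deriv Y)))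
        - fps_const g3 * (4 * (Y * (Y * (Y * fps_deriv Y))))"
      by (simp add: power2_eq_square power3_eq_cube power4_eq_xxxx)
    hence "fps_deriv Y * (2 * fps_deriv (fps_deriv Y)) =
       fps_deriv Y * (4 - 3 * fps_const g2 * Y ^ 2 - 4 * fps_const g3 * Y ^ 3)"
      by algebra
    moreover have "((fps_deriv Y)\<^sup>2) $ 0 = 0"
      using that by (simp add: fps_power_zeroth)
    ultimately show ?thesis using nz by (simp add: fps_power_zeroth)
  qed
  define W where "W = Y - Z"
  \<comment> \<open>\<open>H\<close> collects the quotients of Y^2 - Z^2 and Y^3 - Z^3 by
    \<open>W\<close>; the factor 1/2 undoes the 2 in front of the second derivative.\<close>
  define H where "H = fps_const (1/2) * - (3 * fps_const g2 * (Y + Z) + 4 * fps_const g3 * (Y^2 + Y * Z + Z^2))"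
  have c: "fps_const (1/2) * (2 * X) = X" for X :: "'a fps"
  proof -
    have "fps_const (1/2) * 2 = (1 :: 'a fps)" by (simp add: numeral_fps_const)
    thus ?thesis by (metis mult.assoc mult_1)
  qed
  have "2 * fps_deriv (fps_deriv W) = 2 * fps_deriv (fps_deriv Y) - 2 * fps_deriv (fps_deriv Z)"
    by (simp add: W_def algebra_simps)
  also have "\<dots> = -(3 * fps_const g2 * (Y + Z) + 4 * fps_const g3 * (Y^2 + Y * Z + Z^2)) * W"
    using 1[OF Y] 1[OF Z] by (simp add: W_def algebra_simps power2_eq_square power3_eq_cube)
  finally have "fps_const (1/2) * (2 * fps_deriv (fps_deriv W)) = H * W"
    by (simp only: H_def mult.assoc)
  hence "fps_deriv (fps_deriv W) = H * W" by (simp only: c)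
  hence "W = 0"
    by (rule fps_linear_ode_zero) (use 1[OF Y] 1[OF Z] Y(2) Z(2) in \<open>simp_all add: W_def\<close>)
  thus ?thesis by (simp add: W_def)
qed

text \<open>Gauss's equation, compared coefficientwise, is the recurrence for successive
  hypergeometric coefficients. The condition on \<open>c\<close> keeps the denominators in that
  recurrence nonzero.\<close>

lemma fps_hypergeo_ode:
  fixes a b c :: "'a :: field_char_0"
  assumes "\<And>n. c + of_nat n \<noteq> 0"
  defines "F \<equiv> fps_hypergeo [a, b] [c] 1"
  shows "fps_X * (1 - fps_X) * fps_deriv (fps_deriv F) +
    (fps_const c - fps_const (a + b + 1) * fps_X) * fps_deriv F = fps_const (a * b) * F"
proof (rule fps_ext)
  fix n
  have rec: "(c + of_nat n) * of_nat (Suc n) * F $ Suc n = (a + of_nat n) * (b + of_nat n) * F $ n" for n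
  proof -
    have "(of_nat (Suc n) :: 'a) \<noteq> 0"
      using of_nat_neq_0 by blast
    moreover have "F $ Suc n = (a + of_nat n) * (b + of_nat n) / (of_nat (Suc n) * (c + of_nat n)) * F $ n"
      unfolding F_def fps_hypergeo_rec by simp
    ultimately show ?thesis using assms(1)[of n] by simp
  qed
  show "(fps_X * (1 - fps_X) * fps_deriv (fps_deriv F) +
    (fps_const c - fps_const (a + b + 1) * fps_X) * fps_deriv F) $ n = (fps_const (a * b) * F) $ n"
  proof (cases n)
    case 0
    show ?thesis using rec[of 0]
      by (simp add: 0 ring_distribs mult.assoc del: fps_const_add)
  next
    case (Suc m)
    show ?thesis using rec[of n]
      by (cases m) (simp_all add: Suc algebra_simps del: fps_const_add)
  qed
qed

text \<open>Both sides solve G'' = -(1 - 2a)^2 G with G(0) = 1 and G'(0) = 0; for the left side this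
  is Gauss's equation with sin^2 substituted for the variable. At a = 1/3 the right side becomes cos
  (y/3).\<close>

lemma fps_cos_mult_hypergeo_sin:
  fixes a :: "'a :: field_char_0"
  shows "fps_cos 1 * (fps_hypergeo [a, 1 - a] [1/2] 1 oo (fps_sin 1)\<^sup>2) = fps_cos (1 - 2 * a)"
proof -
  define F where "F = fps_hypergeo [a, 1 - a] [1/2] (1::'a)"
  define s c where "s = fps_sin (1::'a)" and "c = fps_cos (1::'a)"
  have ds: "fps_deriv s = c" "fps_deriv c = -s"
    by (simp_all add: s_def c_def fps_sin_deriv fps_cos_deriv flip: fps_const_neg)
  have s0: "(s\<^sup>2) $ 0 = 0" by (simp add: s_def fps_power_zeroth)
  have sc: "c\<^sup>2 = 1 - s\<^sup>2"
    using fps_sin_cos_sum_of_squares[of "1::'a"] by (simp add: s_def c_def algebra_simps)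
  \<comment> \<open>These are \<open>F\<close> and its first two derivatives at sin^2. By the chain
    rule, the second derivative of \<open>G\<close> is expressible through them.\<close>
  define F0 F1 F2 where "F0 = F oo s\<^sup>2" and "F1 = fps_deriv F oo s\<^sup>2" and "F2 = fps_deriv (fps_deriv F) oo s\<^sup>2"
  have dF: "fps_deriv F0 = F1 * (2 * s * c)" "fps_deriv F1 = F2 * (2 * s * c)"
    unfolding F0_def F1_def F2_def using s0
    by (simp_all add: fps_compose_deriv power2_eq_square ds algebra_simps)
  have half: "(1/2 :: 'a) + of_nat n \<noteq> 0" for n
  proof -
    have "(1/2 :: 'a) + of_nat n = of_nat (2 * n + 1) / 2" by (simp add: field_simps)
    thus ?thesis by (metis add_is_0 divide_eq_0_iff of_nat_eq_0_iff zero_neq_numeral zero_neq_one)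
  qed
  have "(fps_X * (1 - fps_X) * fps_deriv (fps_deriv F) +
    (fps_const (1/2) - fps_const (a + (1 - a) + 1) * fps_X) * fps_deriv F) oo s\<^sup>2
     = (fps_const (a * (1 - a)) * F) oo s\<^sup>2"
    unfolding F_def using fps_hypergeo_ode[OF half, of a "1 - a"] by simp
  hence ode: "s\<^sup>2 * (1 - s\<^sup>2) * F2 + (fps_const (1/2) - 2 * s\<^sup>2) * F1 = fps_const (a * (1 - a)) * F0"
    using s0 by (simp add: fps_compose_mult_distrib fps_compose_add_distrib fps_compose_sub_distrib
      F0_def F1_def F2_def numeral_fps_const)
  define h where "h = fps_const (1/2 :: 'a)"
  have four: "4 * h = 2" by (simp add: h_def numeral_fps_const)
  have lam: "4 * fps_const (a * (1 - a)) - 1 = - fps_const ((1 - 2 * a)\<^sup>2)"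
    by (simp add: numeral_fps_const fps_const_sub fps_const_neg algebra_simps power2_eq_square flip: fps_const_1_eq_1)
  have "4 * (h * F1) = 2 * F1"
    using four by (metis mult.assoc)
  \<comment> \<open>The left side is what differentiating \<open>G\<close> twice will produce; the
    right side exhibits Gauss's operator in it.\<close>
  hence inner: "4 * s\<^sup>2 * c\<^sup>2 * F2 + (2 * c\<^sup>2 - 6 * s\<^sup>2) * F1 =
      4 * (s\<^sup>2 * (1 - s\<^sup>2) * F2 + (h - 2 * s\<^sup>2) * F1)"
    unfolding sc by (simp add: algebra_simps)
  define G where "G = c * F0"
  have "fps_deriv (fps_deriv G) = c * (4 * s\<^sup>2 * c\<^sup>2 * F2 + (2 * c\<^sup>2 - 6 * s\<^sup>2) * F1 - F0)"
    by (simp add: G_def ds dF algebra_simps power2_eq_square)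
  also have "\<dots> = c * (4 * (s\<^sup>2 * (1 - s\<^sup>2) * F2 + (h - 2 * s\<^sup>2) * F1) - F0)"
    unfolding inner ..
  also have "\<dots> = - fps_const ((1 - 2 * a)\<^sup>2) * G"
    unfolding h_def ode G_def using lam by algebra
  finally have 1: "fps_deriv (fps_deriv G) = - fps_const ((1 - 2 * a)\<^sup>2) * G" .
  have 2: "fps_deriv (fps_deriv (fps_cos b)) = - fps_const (b\<^sup>2) * fps_cos b" for b :: 'a
    by (simp add: fps_cos_deriv fps_sin_deriv power2_eq_square mult.assoc flip: fps_const_mult fps_const_neg)
  have "G - fps_cos (1 - 2 * a) = 0"
  proof (rule fps_linear_ode_zero)
    show "fps_deriv (fps_deriv (G - fps_cos (1 - 2 * a))) = - fps_const ((1 - 2 * a)\<^sup>2) * (G - fps_cos (1 - 2 * a))"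
      using 1 2 by (simp add: algebra_simps)
    show "(G - fps_cos (1 - 2 * a)) $ 0 = 0"
      by (simp add: G_def F0_def c_def F_def del: fps_hypergeo_nth)
    have "fps_deriv G $ 0 = 0" "fps_deriv (fps_cos (1 - 2 * a)) $ 0 = 0"
      by (simp_all add: G_def ds dF fps_cos_deriv) (simp_all add: s_def)
    thus "(G - fps_cos (1 - 2 * a)) $ 1 = 0" by simp
  qed
  thus ?thesis by (simp add: G_def F0_def F_def s_def c_def)
qed

subsection \<open>Meromorphic solutions of the Weierstrass equation\<close>

lemma analytic_eq_at_imp_nhds:
  fixes f g :: "complex \<Rightarrow> complex"
  assumes "f analytic_on {z}" "g analytic_on {z}" "\<forall>\<^sub>F w in at z. f w = g w"
  shows "\<forall>\<^sub>F w in nhds z. f w = g w"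
proof -
  have "f \<midarrow>z\<rightarrow> f z" "g \<midarrow>z\<rightarrow> g z"
    using assms(1,2) by (auto intro!: isContD analytic_at_imp_isCont)
  moreover from this(1) have "g \<midarrow>z\<rightarrow> f z"
    using assms(3) by (rule Lim_transform_eventually)
  ultimately have "f z = g z" using LIM_unique by blast
  thus ?thesis using assms(3)
    unfolding eventually_at_filter by (auto elim!: eventually_mono)
qed

text \<open>The difference either vanishes or avoids 0 outside a sparse set, and the second case
  contradicts the agreement near \<open>a\<close>.\<close>

lemma meromorphic_eq_at_propagate:
  assumes "f meromorphic_on UNIV" "g meromorphic_on UNIV" "\<forall>\<^sub>F w in at a. f w = g w"
  shows "\<forall>\<^sub>F w in at z. f w = g w"
proof -
  have "(\<lambda>w. f w - g w) meromorphic_on UNIV"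
    using assms by (intro meromorphic_intros)
  from meromorphic_imp_constant_or_avoid[OF this open_UNIV connected_UNIV, of 0]
  have "eventually (\<lambda>w. f w - g w = 0) (cosparse UNIV) \<or> eventually (\<lambda>w. f w - g w \<noteq> 0) (cosparse UNIV)"
    by simp
  moreover have "\<not> eventually (\<lambda>w. f w - g w \<noteq> 0) (at a)"
  proof
    assume "eventually (\<lambda>w. f w - g w \<noteq> 0) (at a)"
    with assms(3) have "\<forall>\<^sub>F w in at a. False" by eventually_elim simp
    thus False by simp
  qed
  ultimately show ?thesis
    by (auto simp: eventually_cosparse_open_eq)
qed

text \<open>The value at the centre is the limit, or 0 at a pole, so the punctured neighbourhood
  determines it.\<close>

lemma nicely_meromorphic_eq_at:
  assumes "f nicely_meromorphic_on {z}" "g nicely_meromorphic_on {z}" "\<forall>\<^sub>F w in at z. f w = g w"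
  shows "f z = g z"
proof (cases "is_pole f z")
  case True
  hence "is_pole g z" using is_pole_cong[OF assms(3)] by simp
  with True show ?thesis using assms by (metis is_pole_zero_at_nicely_mero singletonI)
next
  case False
  hence "\<not> is_pole g z" using is_pole_cong[OF assms(3)] by simp
  with False show ?thesis
    using assms nicely_meromorphic_on_imp_analytic_at[of f "{z}" z] nicely_meromorphic_on_imp_analytic_at[of g "{z}" z]
      analytic_eq_at_imp_nhds[of f z g] eventually_nhds_x_imp_x by auto
qed

lemma nicely_meromorphic_eqI:
  assumes "f nicely_meromorphic_on UNIV" "g nicely_meromorphic_on UNIV" "\<forall>\<^sub>F w in at a. f w = g w"
  shows "f z = g z"
proof (rule nicely_meromorphic_eq_at[where f = f and g = g and z = z])
  show "f nicely_meromorphic_on {z}" "g nicely_meromorphic_on {z}"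
    using assms nicely_meromorphic_on_subset by blast+
  show "\<forall>\<^sub>F w in at z. f w = g w"
    by (rule meromorphic_eq_at_propagate[of f g a]) (use assms in \<open>auto simp: nicely_meromorphic_on_def\<close>)
qed

lemma nicely_meromorphic_on_compose_affine:
  assumes "f nicely_meromorphic_on UNIV" "e \<noteq> 0"
  shows "(\<lambda>z. f (p + e * z)) nicely_meromorphic_on UNIV"
  unfolding nicely_meromorphic_on_def
proof (intro conjI ballI)
  show "(\<lambda>z. f (p + e * z)) meromorphic_on UNIV"
    by (rule meromorphic_on_compose[of f UNIV "\<lambda>z. p + e * z"])
       (use assms in \<open>auto simp: nicely_meromorphic_on_def intro!: analytic_intros\<close>)
next
  fix z
  have lim: "filterlim (\<lambda>z. p + e * z) (at (p + e * z)) (at z)"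
    using assms(2) by (auto simp: filterlim_at eventually_at_filter intro!: tendsto_intros)
  have "(is_pole f (p + e * z) \<and> f (p + e * z) = 0) \<or> f \<midarrow>p + e * z\<rightarrow> f (p + e * z)"
    using assms(1) by (auto simp: nicely_meromorphic_on_def)
  thus "is_pole (\<lambda>z. f (p + e * z)) z \<and> f (p + e * z) = 0 \<or> (\<lambda>z. f (p + e * z)) \<midarrow>z\<rightarrow> f (p + e * z)"
    using filterlim_compose[OF _ lim] unfolding is_pole_def by blast
qed

text \<open>Conjugation is not analytic, so composition rules for meromorphic functions do not
  apply. Limits, poles and isolated singularities are transferred one by one.\<close>

lemma nicely_meromorphic_on_cnj_cnj:
  assumes "f nicely_meromorphic_on UNIV"
  shows "(\<lambda>z. cnj (f (cnj z))) nicely_meromorphic_on UNIV"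
proof -
  have lim: "filterlim cnj (at (cnj z)) (at z)" for z
    by (auto simp: filterlim_at eventually_at_filter intro!: tendsto_intros)
  have lim2: "(\<lambda>z. cnj (f (cnj z))) \<midarrow>z\<rightarrow> cnj c" if "f \<midarrow>cnj z\<rightarrow> c" for z c
    using filterlim_compose[OF that lim] by (rule tendsto_cnj)
  have pole: "is_pole (\<lambda>z. cnj (f (cnj z))) z" if "is_pole f (cnj z)" for z
    using filterlim_compose[OF that[unfolded is_pole_def] lim]
    by (simp add: is_pole_def filterlim_at_infinity_conv_norm_at_top)
  have dich: "(is_pole f z \<and> f z = 0) \<or> f \<midarrow>z\<rightarrow> f z" for z
    using assms by (auto simp: nicely_meromorphic_on_def)
  show ?thesis unfolding nicely_meromorphic_on_def
  proof
    show "\<forall>z\<in>UNIV. is_pole (\<lambda>z. cnj (f (cnj z))) z \<and> cnj (f (cnj z)) = 0 \<or>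
        (\<lambda>z. cnj (f (cnj z))) \<midarrow>z\<rightarrow> cnj (f (cnj z))"
      using dich lim2 pole by fastforce
    show "(\<lambda>z. cnj (f (cnj z))) meromorphic_on UNIV"
      unfolding meromorphic_on_altdef
    proof (safe)
      fix z
      show "not_essential (\<lambda>z. cnj (f (cnj z))) z"
        using dich[of "cnj z"] lim2[where z = z] pole[of z] unfolding not_essential_def by blast
      have "isolated_singularity_at f (cnj z)"
        using assms by (auto simp: nicely_meromorphic_on_def meromorphic_on_altdef)
      then obtain r where r: "r > 0" "f analytic_on ball (cnj z) r - {cnj z}"
        unfolding isolated_singularity_at_def by blast
      have "cnj ` (ball z r - {z}) \<subseteq> ball (cnj z) r - {cnj z}"
        by (auto simp: dist_norm simp flip: complex_cnj_diff)
      hence "cnj \<circ> f \<circ> cnj holomorphic_on ball z r - {z}"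
        using r by (intro holomorphic_on_compose_cnj_cnj)
         (auto intro: holomorphic_on_subset analytic_imp_holomorphic)
      thus "isolated_singularity_at (\<lambda>z. cnj (f (cnj z))) z"
        unfolding isolated_singularity_at_def using r(1)
        by (intro exI[of _ r]) (simp add: analytic_on_open open_delete comp_def)
    qed
  qed
qed

section \<open>Uniqueness of the Weierstrass germ at a pole\<close>

text \<open>Taking reciprocals turns the pole into a zero, so that the solution becomes a power
  series to which \<open>fps_weierstrass_ode_unique\<close> applies.\<close>

lemma weierstrass_germ_reciprocal:
  assumes "f meromorphic_on {0}" "is_pole f 0"
    and "\<forall>\<^sub>F z in at 0. (deriv f z)\<^sup>2 = 4 * f z ^ 3 - g2 * f z - g3"
  obtains y Y where "y has_fps_expansion Y" "\<forall>\<^sub>F z in at 0. f z = inverse (y z)"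
    "(fps_deriv Y)\<^sup>2 = 4 * Y - fps_const g2 * Y ^ 3 - fps_const g3 * Y ^ 4" "fps_nth Y 0 = 0" "Y \<noteq> 0"
proof -
  have nz: "\<forall>\<^sub>F z in at 0. f z \<noteq> 0"
    using assms(2) by (rule non_zero_neighbour_pole)
  have "isolated_singularity_at f 0"
    using assms(1) by (simp add: meromorphic_at_iff)
  then obtain r1 where r1: "r1 > 0" "f analytic_on ball 0 r1 - {0}"
    unfolding isolated_singularity_at_def by blast
  from nz obtain r2 where r2: "r2 > 0" "\<And>z. z \<in> ball 0 r2 - {0} \<Longrightarrow> f z \<noteq> 0"
    unfolding eventually_at by (auto simp: dist_commute)
  define r where "r = min r1 r2"
  have r: "r > 0" "f analytic_on ball 0 r - {0}" "\<forall>z\<in>ball 0 r - {0}. f z \<noteq> 0"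
    using r1 r2 by (auto simp: r_def intro: analytic_on_subset)
  \<comment> \<open>The hypotheses do not fix \<open>f 0\<close>, so the removable singularity of
    1/f is filled with 0 explicitly.\<close>
  define y where "y = (\<lambda>z. if z = 0 then 0 else inverse (f z))"
  have "y holomorphic_on ball 0 r"
    unfolding y_def using r assms(2)
    by (intro is_pole_inverse_holomorphic) (auto intro: analytic_imp_holomorphic)
  hence ana: "y analytic_on {0}"
    unfolding analytic_at using r(1) by (intro exI[of _ "ball 0 r"]) auto
  define Y where "Y = fps_expansion y 0"
  have Y: "y has_fps_expansion Y"
    unfolding Y_def using ana by (rule analytic_at_imp_has_fps_expansion_0)
  have ball: "\<forall>\<^sub>F z in at 0. z \<in> ball 0 r - {0}"
    using r(1) by (intro eventually_at_in_open) auto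
  have fy: "\<forall>\<^sub>F z in at 0. f z = inverse (y z)"
    using ball by eventually_elim (auto simp: y_def)
  have "\<forall>\<^sub>F z in at 0. (deriv y z)\<^sup>2 = 4 * y z - g2 * y z ^ 3 - g3 * y z ^ 4"
    using ball assms(3)
  proof eventually_elim
    case (elim z)
    have "f field_differentiable at z"
      using r(2) elim(1) analytic_on_imp_differentiable_at by blast
    hence "((\<lambda>z. inverse (f z)) has_field_derivative - deriv f z / (f z)\<^sup>2) (at z)"
      using r(3) elim(1) by (auto intro!: derivative_eq_intros simp: field_differentiable_derivI divide_inverse power2_eq_square)
    hence "(y has_field_derivative - deriv f z / (f z)\<^sup>2) (at z)"
      by (rule has_field_derivative_transform_within_open[of _ _ _ "ball 0 r - {0}"])
         (use elim in \<open>auto simp: y_def\<close>)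
    hence "deriv y z = - deriv f z / (f z)\<^sup>2" by (rule DERIV_imp_deriv)
    \<comment> \<open>Dividing the Weierstrass equation by f^4 gives the equation of the
      reciprocal.\<close>
    hence "(deriv y z)\<^sup>2 = (4 * f z ^ 3 - g2 * f z - g3) / (f z) ^ 4"
      using elim(2) by (simp add: power_divide flip: power_mult)
    also have "\<dots> = 4 * y z - g2 * y z ^ 3 - g3 * y z ^ 4"
      using r(3) elim(1) by (simp add: y_def field_simps eval_nat_numeral)
    finally show ?case .
  qed
  \<comment> \<open>Both sides are analytic at 0, so the equation extends to 0 and power series can
    be compared.\<close>
  hence "\<forall>\<^sub>F z in nhds 0. (deriv y z)\<^sup>2 = 4 * y z - g2 * y z ^ 3 - g3 * y z ^ 4"
    by (intro analytic_eq_at_imp_nhds analytic_intros ana)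
  moreover have "(\<lambda>z. (deriv y z)\<^sup>2) has_fps_expansion (fps_deriv Y)\<^sup>2"
    by (intro fps_expansion_intros Y)
  moreover have "(\<lambda>z. 4 * y z - g2 * y z ^ 3 - g3 * y z ^ 4) has_fps_expansion
      4 * Y - fps_const g2 * Y ^ 3 - fps_const g3 * Y ^ 4"
    by (intro fps_expansion_intros Y)
  ultimately have ode: "(fps_deriv Y)\<^sup>2 = 4 * Y - fps_const g2 * Y ^ 3 - fps_const g3 * Y ^ 4"
    by (subst (asm) has_fps_expansion_cong[OF _ refl]) (auto intro: fps_expansion_unique_complex)
  have "fps_nth Y 0 = 0"
    using fps_nth_fps_expansion[OF Y, of 0] by (simp add: y_def)
  moreover have "Y \<noteq> 0"
  proof
    assume "Y = 0"
    hence "\<forall>\<^sub>F z in nhds 0. y z = 0"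
      using Y by (auto simp: has_fps_expansion_def elim!: eventually_mono)
    hence "\<forall>\<^sub>F z in at 0. y z = 0" by (rule filter_leD[OF at_within_le_nhds])
    hence "\<forall>\<^sub>F z in at (0::complex). False"
      using ball by eventually_elim (use r(3) in \<open>auto simp: y_def\<close>)
    thus False by simp
  qed
  ultimately show thesis using that Y fy ode by blast
qed

lemma weierstrass_germ_unique:
  assumes f: "f meromorphic_on {0}" "is_pole f 0"
    "\<forall>\<^sub>F z in at 0. (deriv f z)\<^sup>2 = 4 * f z ^ 3 - g2 * f z - g3"
  assumes g: "g meromorphic_on {0}" "is_pole g 0"
    "\<forall>\<^sub>F z in at 0. (deriv g z)\<^sup>2 = 4 * g z ^ 3 - g2 * g z - g3"
  shows "\<forall>\<^sub>F z in at 0. f z = g z"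
proof -
  obtain x X where X: "x has_fps_expansion X" "\<forall>\<^sub>F z in at 0. f z = inverse (x z)"
    "(fps_deriv X)\<^sup>2 = 4 * X - fps_const g2 * X ^ 3 - fps_const g3 * X ^ 4" "fps_nth X 0 = 0" "X \<noteq> 0"
    using weierstrass_germ_reciprocal[OF f] .
  obtain y Y where Y: "y has_fps_expansion Y" "\<forall>\<^sub>F z in at 0. g z = inverse (y z)"
    "(fps_deriv Y)\<^sup>2 = 4 * Y - fps_const g2 * Y ^ 3 - fps_const g3 * Y ^ 4" "fps_nth Y 0 = 0" "Y \<noteq> 0"
    using weierstrass_germ_reciprocal[OF g] .
  have "X = Y" by (rule fps_weierstrass_ode_unique[OF X(3-5) Y(3-5)])
  hence "\<forall>\<^sub>F z in nhds 0. x z = y z"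
    using X(1) Y(1) by (auto simp: has_fps_expansion_def elim: eventually_elim2)
  hence "\<forall>\<^sub>F z in at 0. x z = y z" by (rule filter_leD[OF at_within_le_nhds])
  thus ?thesis using X(2) Y(2) by eventually_elim simp
qed

lemma meromorphic_eventually_analytic:
  assumes "f meromorphic_on UNIV"
  shows "\<forall>\<^sub>F z in at p. f analytic_on {z}"
  using assms by (auto simp: meromorphic_on_altdef isolated_singularity_at_altdef)

section \<open>Symmetries of Weierstrass functions\<close>

lemma weierstrass_function_analytic:
  assumes "weierstrass_function g2 g3 P" "\<not> is_pole P z"
  shows "P analytic_on {z}"
  using assms nicely_meromorphic_on_imp_analytic_at by (auto simp: weierstrass_function_def)

lemma weierstrass_function_ode_at:
  assumes "weierstrass_function g2 g3 P"
  shows "\<forall>\<^sub>F z in at p. P analytic_on {z} \<and> (deriv P z)\<^sup>2 = 4 * P z ^ 3 - g2 * P z - g3"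
proof -
  have "\<forall>\<^sub>F z in at p. P analytic_on {z}"
    using assms by (intro meromorphic_eventually_analytic) (auto simp: weierstrass_function_def nicely_meromorphic_on_def)
  thus ?thesis
    by eventually_elim (use assms in \<open>auto simp: weierstrass_function_def dest: analytic_at_imp_no_pole\<close>)
qed

text \<open>The substituted function has a pole at 0 and solves the same equation, because
  \<open>e\<close> enters the squared derivative only through e^2 = 1. Germ uniqueness and the
  identity theorem finish the argument. Evenness is the case p = 0, e = -1; periodicity under
  translation by a pole is the case e = 1.\<close>

lemma weierstrass_function_affine:
  assumes P: "weierstrass_function g2 g3 P" and p: "is_pole P p" and e: "e\<^sup>2 = 1"
  shows "P (p + e * z) = P z"
proof -
  have e0: "e \<noteq> 0" using e by auto
  have nP: "P nicely_meromorphic_on UNIV" using P by (simp add: weierstrass_function_def)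
  have mP: "P meromorphic_on UNIV" using nP by (simp add: nicely_meromorphic_on_def)
  have np: "(\<lambda>z. P (p + e * z)) nicely_meromorphic_on UNIV"
    using nP e0 by (rule nicely_meromorphic_on_compose_affine)
  have lim: "filterlim (\<lambda>z. p + e * z) (at p) (at 0)"
    using e0 by (auto simp: filterlim_at eventually_at_filter intro!: tendsto_eq_intros)
  have "\<forall>\<^sub>F z in at 0. P (p + e * z) = P z"
  proof (rule weierstrass_germ_unique)
    show "(\<lambda>z. P (p + e * z)) meromorphic_on {0}" "P meromorphic_on {0}"
      using np mP by (auto simp: nicely_meromorphic_on_def intro: meromorphic_on_subset)
    show "is_pole (\<lambda>z. P (p + e * z)) 0"
      using p lim filterlim_compose unfolding is_pole_def by blast
    show "is_pole P 0" using P by (simp add: weierstrass_function_def)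
    show "\<forall>\<^sub>F z in at 0. (deriv P z)\<^sup>2 = 4 * P z ^ 3 - g2 * P z - g3"
      using weierstrass_function_ode_at[OF P] by eventually_elim simp
    have "\<forall>\<^sub>F z in at 0. P analytic_on {p + e * z} \<and>
        (deriv P (p + e * z))\<^sup>2 = 4 * P (p + e * z) ^ 3 - g2 * P (p + e * z) - g3"
      using weierstrass_function_ode_at[OF P, of p] lim by (rule eventually_compose_filterlim)
    thus "\<forall>\<^sub>F z in at 0. (deriv (\<lambda>z. P (p + e * z)) z)\<^sup>2 = 4 * P (p + e * z) ^ 3 - g2 * P (p + e * z) - g3"
    proof eventually_elim
      case (elim z)
      hence "(P has_field_derivative deriv P (p + e * z)) (at (p + e * z))"
        using analytic_derivI by blast
      moreover have "((\<lambda>z. p + e * z) has_field_derivative e) (at z)"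
        by (auto intro!: derivative_eq_intros)
      ultimately have "deriv (\<lambda>z. P (p + e * z)) z = deriv P (p + e * z) * e"
        by (intro DERIV_imp_deriv) (rule DERIV_chain2)
      thus ?case using elim e by (simp add: power_mult_distrib)
    qed
  qed
  thus ?thesis using nicely_meromorphic_eqI[OF np nP] by blast
qed

lemma weierstrass_function_even:
  assumes "weierstrass_function g2 g3 P"
  shows "P (- z) = P z"
  using weierstrass_function_affine[OF assms, of 0 "-1"] assms by (simp add: weierstrass_function_def)

lemma weierstrass_function_pole_is_period:
  assumes "weierstrass_function g2 g3 P" "is_pole P p"
  shows "p \<in> periods P"
  using weierstrass_function_affine[OF assms, of 1] by (simp add: periods_def add.commute)

text \<open>Evenness and the period 2h give P(2h - z) = P(z), so P'(h) = -P'(h). Since poles are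
  periods, \<open>P\<close> has no pole at \<open>h\<close>.\<close>

lemma weierstrass_function_half_period:
  assumes P: "weierstrass_function g2 g3 P" and "2 * h \<in> periods P" "h \<notin> periods P"
  shows "P analytic_on {h}" "deriv P h = 0" "4 * P h ^ 3 - g2 * P h - g3 = 0"
proof -
  have np: "\<not> is_pole P h" using weierstrass_function_pole_is_period assms by blast
  thus ana: "P analytic_on {h}" using weierstrass_function_analytic P by blast
  have sym: "P (2 * h - z) = P z" for z
  proof -
    have "P (- z + 2 * h) = P (- z)" using assms(2) unfolding periods_def by blast
    thus ?thesis using weierstrass_function_even[OF P, of z] by simp
  qed
  have D: "(P has_field_derivative deriv P h) (at h)"
    using ana analytic_derivI by blast
  have "((\<lambda>z. P (2 * h - z)) has_field_derivative deriv P h * (- 1)) (at h)"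
    by (rule DERIV_chain2) (use D in \<open>auto intro!: derivative_eq_intros\<close>)
  hence "(P has_field_derivative - deriv P h) (at h)"
    by (simp add: sym)
  with D have "deriv P h = - deriv P h" by (rule DERIV_unique)
  thus deriv: "deriv P h = 0" by simp
  have "(deriv P h)\<^sup>2 = 4 * P h ^ 3 - g2 * P h - g3"
    using P np by (simp add: weierstrass_function_def)
  thus "4 * P h ^ 3 - g2 * P h - g3 = 0" by (simp add: deriv)
qed

text \<open>With real invariants, conjugating argument and value gives another solution with a pole
  at 0, hence the same function.\<close>

lemma weierstrass_function_cnj:
  assumes P: "weierstrass_function (of_real g2) (of_real g3) P"
  shows "P (cnj z) = cnj (P z)"
proof -
  have nP: "P nicely_meromorphic_on UNIV" using P by (simp add: weierstrass_function_def)
  have np: "(\<lambda>z. cnj (P (cnj z))) nicely_meromorphic_on UNIV"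
    using nP by (rule nicely_meromorphic_on_cnj_cnj)
  have lim: "filterlim cnj (at 0) (at 0)"
    by (auto simp: filterlim_at eventually_at_filter intro!: tendsto_eq_intros)
  have pole: "is_pole P 0" using P by (simp add: weierstrass_function_def)
  have "\<forall>\<^sub>F z in at 0. cnj (P (cnj z)) = P z"
  proof (rule weierstrass_germ_unique)
    show "(\<lambda>z. cnj (P (cnj z))) meromorphic_on {0}" "P meromorphic_on {0}"
      using np nP by (auto simp: nicely_meromorphic_on_def intro: meromorphic_on_subset)
    show "is_pole (\<lambda>z. cnj (P (cnj z))) 0"
      using filterlim_compose[OF pole[unfolded is_pole_def] lim]
      by (simp add: is_pole_def filterlim_at_infinity_conv_norm_at_top)
    show "is_pole P 0" by (fact pole)
    show "\<forall>\<^sub>F z in at 0. (deriv P z)\<^sup>2 = 4 * P z ^ 3 - of_real g2 * P z - of_real g3"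
      using weierstrass_function_ode_at[OF P] by eventually_elim simp
    have "\<forall>\<^sub>F z in at 0. P analytic_on {cnj z} \<and>
        (deriv P (cnj z))\<^sup>2 = 4 * P (cnj z) ^ 3 - of_real g2 * P (cnj z) - of_real g3"
      using weierstrass_function_ode_at[OF P, of 0] lim by (rule eventually_compose_filterlim)
    thus "\<forall>\<^sub>F z in at 0. (deriv (\<lambda>z. cnj (P (cnj z))) z)\<^sup>2 =
       4 * cnj (P (cnj z)) ^ 3 - of_real g2 * cnj (P (cnj z)) - of_real g3"
    proof eventually_elim
      case (elim z)
      hence "(P has_field_derivative deriv P (cnj z)) (at (cnj z))"
        using analytic_derivI by blast
      from has_field_derivative_cnj_cnj[OF this]
      have "deriv (\<lambda>z. cnj (P (cnj z))) z = cnj (deriv P (cnj z))"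
        by (intro DERIV_imp_deriv) (simp add: comp_def)
      moreover have "cnj ((deriv P (cnj z))\<^sup>2) = cnj (4 * P (cnj z) ^ 3 - of_real g2 * P (cnj z) - of_real g3)"
        using elim by simp
      ultimately show ?case by simp
    qed
  qed
  from nicely_meromorphic_eqI[OF np nP this, of "cnj z"] show ?thesis by simp
qed

subsection \<open>The differential equation of \<open>dn\<^sub>3\<close>\<close>

lemma shifted_nat_ratio_tendsto:
  fixes a c :: complex
  shows "(\<lambda>n. (a + of_nat n) / (c + of_nat n)) \<longlonglongrightarrow> 1"
proof -
  have lim: "filterlim (\<lambda>n. c + of_nat n) at_infinity sequentially"
    by (rule tendsto_add_filterlim_at_infinity[OF tendsto_const tendsto_of_nat])
  have "(\<lambda>n. 1 + (a - c) / (c + of_nat n)) \<longlonglongrightarrow> 1 + 0"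
    by (intro tendsto_add tendsto_const tendsto_divide_0[OF tendsto_const lim])
  moreover have "\<forall>\<^sub>F n in sequentially. 1 + (a - c) / (c + of_nat n) = (a + of_nat n) / (c + of_nat n)"
    using filterlim_at_infinity_imp_eventually_ne[OF lim, of 0]
    by eventually_elim (simp add: field_simps)
  ultimately show ?thesis using Lim_transform_eventually by fastforce
qed

lemma fps_conv_radius_hypergeo_pos:
  "fps_conv_radius (fps_hypergeo [a, b] [c] 1 :: complex fps) > 0"
proof -
  define F where "F = fps_nth (fps_hypergeo [a, b] [c] (1::complex))"
  \<comment> \<open>\<open>q\<close> is the ratio of consecutive terms of the series at 1/2. It
    tends to 1/2, so any bound strictly between 1/2 and 1 serves in the ratio test.\<close>
  define q where "q = (\<lambda>n. (a + of_nat n) / (c + of_nat n) * ((b + of_nat n) / (1 + of_nat n)) / 2)"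
  have "q \<longlonglongrightarrow> 1 * 1 / 2"
    unfolding q_def by (intro tendsto_intros shifted_nat_ratio_tendsto) auto
  hence "(\<lambda>n. norm (q n)) \<longlonglongrightarrow> 1 / 2"
    by (rule tendsto_eq_rhs[OF tendsto_norm]) simp
  hence "\<forall>\<^sub>F n in sequentially. norm (q n) < 3 / 4"
    by (rule order_tendstoD) simp
  then obtain N where N: "\<And>n. n \<ge> N \<Longrightarrow> norm (q n) < 3 / 4"
    unfolding eventually_sequentially by blast
  have rec: "F (Suc n) * (1 / 2) ^ Suc n = q n * (F n * (1 / 2) ^ n)" for n
    unfolding F_def fps_hypergeo_rec q_def by (simp add: field_simps del: fps_hypergeo_nth)
  have "summable (\<lambda>n. F n * (1 / 2) ^ n)"
  proof (rule summable_ratio_test[of "3 / 4" N])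
    fix n assume "n \<ge> N"
    thus "norm (F (Suc n) * (1 / 2) ^ Suc n) \<le> 3 / 4 * norm (F n * (1 / 2) ^ n)"
      unfolding rec norm_mult[of "q n"] using N[of n] by (intro mult_right_mono) auto
  qed simp
  hence "fps_conv_radius (fps_hypergeo [a, b] [c] 1) \<ge> ereal (norm (1 / 2 :: complex))"
    unfolding fps_conv_radius_def F_def by (rule conv_radius_geI)
  moreover have "ereal (norm (1 / 2 :: complex)) > 0" by simp
  ultimately show ?thesis by (metis less_le_trans)
qed

text \<open>The positive radius of convergence lets the formal identity
  \<open>fps_cos_mult_hypergeo_sin\<close> pass to functions near 0.\<close>

lemma hyp2F1_half_sin:
  "\<forall>\<^sub>F y in nhds 0. cos y * hyp2F1 a (1 - a) (1 / 2) ((sin y)\<^sup>2) = cos ((1 - 2 * a) * y)"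
proof -
  define F where "F = fps_hypergeo [a, 1 - a] [1 / 2] (1::complex)"
  have "eval_fps F has_fps_expansion F"
    unfolding F_def by (intro eval_fps_has_fps_expansion fps_conv_radius_hypergeo_pos)
  moreover have "(\<lambda>y::complex. (sin y)\<^sup>2) has_fps_expansion (fps_sin 1)\<^sup>2"
    by (intro fps_expansion_intros)
  moreover have "fps_nth ((fps_sin (1::complex))\<^sup>2) 0 = 0"
    by (simp add: fps_power_zeroth)
  ultimately have "(eval_fps F \<circ> (\<lambda>y. (sin y)\<^sup>2)) has_fps_expansion (F oo (fps_sin 1)\<^sup>2)"
    by (rule has_fps_expansion_compose)
  hence "(\<lambda>y. cos y * (eval_fps F \<circ> (\<lambda>y. (sin y)\<^sup>2)) y) has_fps_expansion fps_cos 1 * (F oo (fps_sin 1)\<^sup>2)"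
    by (rule has_fps_expansion_mult[OF has_fps_expansion_cos'])
  moreover have "fps_cos 1 * (F oo (fps_sin 1)\<^sup>2) = fps_cos (1 - 2 * a)"
    unfolding F_def by (rule fps_cos_mult_hypergeo_sin)
  moreover have "(\<lambda>y. cos ((1 - 2 * a) * y)) has_fps_expansion fps_cos (1 - 2 * a)"
    by (rule has_fps_expansion_cos)
  ultimately have "\<forall>\<^sub>F y in nhds 0. cos y * (eval_fps F \<circ> (\<lambda>y. (sin y)\<^sup>2)) y = cos ((1 - 2 * a) * y)"
    by (auto simp: has_fps_expansion_def elim!: eventually_mono)
  thus ?thesis by eventually_elim (simp add: hyp2F1_def F_def)
qed

text \<open>On a disc around 0 the integrand has a primitive, and the integral along the segment is
  its increment.\<close>

lemma contour_integral_linepath_deriv: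
  assumes "h analytic_on {0}"
  shows "\<forall>\<^sub>F T in nhds 0. ((\<lambda>T. contour_integral (linepath 0 T) h) has_field_derivative h T) (at T)"
proof -
  obtain r where r: "r > 0" "h holomorphic_on ball 0 r"
    using assms by (auto simp: analytic_on_def)
  obtain g where g: "\<And>x. x \<in> ball 0 r \<Longrightarrow> (g has_field_derivative h x) (at x within ball 0 r)"
    using holomorphic_convex_primitive'[of "ball 0 r" h] r by auto
  have int: "contour_integral (linepath 0 T) h = g T - g 0" if "T \<in> ball 0 r" for T
  proof (rule contour_integral_unique)
    have "path_image (linepath 0 T) \<subseteq> ball 0 r"
      using closed_segment_subset[of 0 "ball 0 r" T] that r(1) by simp
    from contour_integral_primitive[OF g _ this]
    show "(h has_contour_integral (g T - g 0)) (linepath 0 T)" by simp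
  qed
  have "((\<lambda>T. contour_integral (linepath 0 T) h) has_field_derivative h T) (at T)" if "T \<in> ball 0 r" for T
  proof -
    have "((\<lambda>T. g T - g 0) has_field_derivative h T) (at T)"
      using g[OF that] that by (auto intro!: derivative_eq_intros simp: at_within_open_NO_MATCH)
    thus ?thesis
      by (rule has_field_derivative_transform_within_open[of _ _ _ "ball 0 r"])
         (use that int in auto)
  qed
  thus ?thesis
    using r(1) eventually_nhds_in_open[of "ball 0 r" 0] by (auto elim!: eventually_mono)
qed

lemma eventually_analytic_nhds:
  assumes "f analytic_on {z}"
  shows "\<forall>\<^sub>F w in nhds z. f analytic_on {w}"
proof -
  obtain S where S: "open S" "z \<in> S" "f holomorphic_on S"
    using assms analytic_at by blast
  hence "f analytic_on S" by (simp add: analytic_on_open)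
  thus ?thesis using eventually_nhds_in_open[OF S(1,2)]
    by (auto elim!: eventually_mono intro: analytic_on_subset)
qed

section \<open>Algebraic and differential equations for the derivative of the local inverse\<close>

context
  fixes \<kappa> lam :: real and \<phi> :: "complex \<Rightarrow> complex"
  assumes inv: "analytic_local_inverse_0 (dn3_integral \<kappa>) \<phi>"
begin

text \<open>The identity comes from the substitution \<open>sin y = \<kappa> sin T\<close> with \<open>T = \<phi> u\<close>, under which
  \<open>\<phi>' = cos y / cos (y / 3) = 4 cos\<^sup>2 (y / 3) - 3\<close>.\<close>

lemma deriv_local_inverse_cubic:
  "\<forall>\<^sub>F u in nhds 0. (deriv \<phi> u) ^ 3 + 3 * (deriv \<phi> u)\<^sup>2 = 4 * (1 - (of_real \<kappa>)\<^sup>2 * (sin (\<phi> u))\<^sup>2)"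
  "deriv \<phi> 0 = 1"
proof -
  define h where "h = (\<lambda>t. hyp2F1 (1/3) (2/3) (1/2) ((complex_of_real \<kappa>)\<^sup>2 * (sin t)\<^sup>2))"
  have \<phi>: "\<phi> analytic_on {0}" "\<phi> 0 = 0" "\<forall>\<^sub>F u in nhds 0. dn3_integral \<kappa> (\<phi> u) = u"
    using inv by (auto simp: analytic_local_inverse_0_def)
  have lim: "filterlim \<phi> (nhds 0) (nhds 0)"
    using analytic_at_imp_isCont[OF \<phi>(1)] \<phi>(2) by (simp add: isCont_def tendsto_nhds_iff)
  have h: "h analytic_on {0}"
  proof -
    have F: "eval_fps (fps_hypergeo [1/3, 2/3] [1/2] 1) analytic_on {0::complex}"
      by (intro analytic_on_eval_fps) (auto simp: fps_conv_radius_hypergeo_pos simp flip: zero_ereal_def)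
    have "eval_fps (fps_hypergeo [1/3, 2/3] [1/2] 1) \<circ> (\<lambda>t. (complex_of_real \<kappa>)\<^sup>2 * (sin t)\<^sup>2) analytic_on {0::complex}"
      by (rule analytic_on_compose_gen[OF _ F]) (auto intro!: analytic_intros)
    thus ?thesis by (simp add: h_def hyp2F1_def comp_def)
  qed
  have int: "dn3_integral \<kappa> = (\<lambda>T. contour_integral (linepath 0 T) h)"
    by (simp add: dn3_integral_def h_def fun_eq_iff)
  have \<phi>_ana: "\<forall>\<^sub>F u in nhds 0. \<phi> analytic_on {u}"
    using \<phi>(1) by (rule eventually_analytic_nhds)
  have dint: "\<forall>\<^sub>F u in nhds 0. (dn3_integral \<kappa> has_field_derivative h (\<phi> u)) (at (\<phi> u))"
    using contour_integral_linepath_deriv[OF h] lim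
    unfolding int by (rule eventually_compose_filterlim)
  \<comment> \<open>Differentiating at \<open>u\<close> requires the identity on a whole
    neighbourhood of each \<open>u\<close> near 0.\<close>
  have ev: "\<forall>\<^sub>F u in nhds 0. \<forall>\<^sub>F v in nhds u. dn3_integral \<kappa> (\<phi> v) = v"
    using \<phi>(3) by (simp add: eventually_eventually)
  have inverse_deriv: "\<forall>\<^sub>F u in nhds 0. h (\<phi> u) * deriv \<phi> u = 1"
    using \<phi>_ana dint ev
  proof eventually_elim
    case (elim u)
    have "(\<phi> has_field_derivative deriv \<phi> u) (at u)"
      using elim analytic_derivI by blast
    from DERIV_chain2[OF elim(2) this]
    have "((\<lambda>v. dn3_integral \<kappa> (\<phi> v)) has_field_derivative h (\<phi> u) * deriv \<phi> u) (at u)" .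
    moreover have "((\<lambda>v. dn3_integral \<kappa> (\<phi> v)) has_field_derivative 1) (at u)"
      using DERIV_cong_ev[OF refl elim(3) refl] DERIV_ident by blast
    ultimately show ?case by (rule DERIV_unique)
  qed
  \<comment> \<open>Near 0 this is the branch with \<open>y 0 = 0\<close>, so the closed form of the
    hypergeometric function applies.\<close>
  define y where "y = (\<lambda>u. Arcsin (of_real \<kappa> * sin (\<phi> u)))"
  have "filterlim (\<lambda>u. of_real \<kappa> * sin (\<phi> u)) (nhds 0) (nhds 0)"
    by (rule tendsto_eq_intros lim | simp)+
  moreover have "filterlim Arcsin (nhds 0) (nhds (0::complex))"
    using isCont_Arcsin[of 0] by (simp add: isCont_def tendsto_nhds_iff)
  ultimately have limy: "filterlim y (nhds 0) (nhds 0)"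
    unfolding y_def by (rule filterlim_compose[rotated])
  have "filterlim (\<lambda>u. cos (y u)) (nhds 1) (nhds 0)" "filterlim (\<lambda>u. cos (y u / 3)) (nhds 1) (nhds 0)"
    by (rule tendsto_eq_intros limy | simp)+
  hence nz: "\<forall>\<^sub>F u in nhds 0. cos (y u) \<noteq> 0" "\<forall>\<^sub>F u in nhds 0. cos (y u / 3) \<noteq> 0"
    by (auto intro: tendsto_imp_eventually_ne)
  have hyp: "\<forall>\<^sub>F u in nhds 0. cos (y u) * hyp2F1 (1/3) (1 - 1/3) (1/2) ((sin (y u))\<^sup>2) = cos ((1 - 2 * (1/3)) * y u)"
    using hyp2F1_half_sin limy by (rule eventually_compose_filterlim)
  show "\<forall>\<^sub>F u in nhds 0. (deriv \<phi> u) ^ 3 + 3 * (deriv \<phi> u)\<^sup>2 = 4 * (1 - (of_real \<kappa>)\<^sup>2 * (sin (\<phi> u))\<^sup>2)"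
    using nz hyp inverse_deriv
  proof eventually_elim
    case (elim u)
    define c where "c = cos (y u / 3)"
    have siny: "sin (y u) = of_real \<kappa> * sin (\<phi> u)" by (simp add: y_def)
    have "cos (3 * (y u / 3)) = 4 * c ^ 3 - 3 * c" unfolding c_def by (rule cos_treble_cos)
    hence cy: "cos (y u) = 4 * c ^ 3 - 3 * c" by simp
    have "cos (y u) * h (\<phi> u) = c"
      using elim(3) by (simp add: h_def siny power_mult_distrib c_def)
    hence "cos (y u) * (h (\<phi> u) * deriv \<phi> u) = c * deriv \<phi> u" by (simp only: mult.assoc [symmetric])
    hence "cos (y u) = c * deriv \<phi> u" using elim(4) by simp
    hence "c * deriv \<phi> u = c * (4 * c\<^sup>2 - 3)"
      by (simp add: cy algebra_simps power2_eq_square power3_eq_cube)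
    hence x: "deriv \<phi> u = 4 * c\<^sup>2 - 3" using elim(2) by (simp add: c_def)
    \<comment> \<open>With x = 4c^2 - 3 one has x^2 (x + 3) = 4 (c (4c^2 - 3))^2, and c (4c^2 - 3)
      is the cosine of y by the triple-angle formula.\<close>
    have "(deriv \<phi> u) ^ 3 + 3 * (deriv \<phi> u)\<^sup>2 = 4 * (cos (y u))\<^sup>2"
      unfolding x cy by (simp add: algebra_simps power2_eq_square power3_eq_cube)
    also have "\<dots> = 4 * (1 - (of_real \<kappa>)\<^sup>2 * (sin (\<phi> u))\<^sup>2)"
      by (simp add: cos_squared_eq siny power_mult_distrib)
    finally show ?case .
  qed
  have "h 0 * deriv \<phi> 0 = 1"
    using eventually_nhds_x_imp_x[OF inverse_deriv] \<phi>(2) by simp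
  thus "deriv \<phi> 0 = 1"
    by (simp add: h_def hyp2F1_def eval_fps_at_0 del: fps_hypergeo_nth)
qed

text \<open>Differentiating the cubic relation with \<phi>' = x and cancelling x gives 3 (x + 2) x'
  = -8 \<kappa>^2 sin \<phi> cos \<phi>. After squaring, the cubic relation eliminates the
  trigonometric terms and (x + 2)^2 cancels.\<close>

lemma deriv_local_inverse_ode:
  assumes "\<kappa>\<^sup>2 + lam\<^sup>2 = 1"
  shows "\<forall>\<^sub>F u in nhds 0. 9 * (deriv (deriv \<phi>) u)\<^sup>2 = 4 * (1 - deriv \<phi> u) *
     ((deriv \<phi> u) ^ 3 + 3 * (deriv \<phi> u)\<^sup>2 - 4 * (of_real lam)\<^sup>2)"
proof -
  define x where "x = deriv \<phi>"
  define k where "k = complex_of_real \<kappa>"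
  have \<phi>: "\<phi> analytic_on {0}" using inv by (auto simp: analytic_local_inverse_0_def)
  have x: "x analytic_on {0}" unfolding x_def using \<phi> by (rule analytic_deriv)
  have cub: "\<forall>\<^sub>F u in nhds 0. x u ^ 3 + 3 * (x u)\<^sup>2 = 4 * (1 - k\<^sup>2 * (sin (\<phi> u))\<^sup>2)"
    using deriv_local_inverse_cubic(1) by (simp add: x_def k_def)
  hence ev: "\<forall>\<^sub>F u in nhds 0. \<forall>\<^sub>F v in nhds u. x v ^ 3 + 3 * (x v)\<^sup>2 = 4 * (1 - k\<^sup>2 * (sin (\<phi> v))\<^sup>2)"
    by (simp add: eventually_eventually)
  have "isCont x 0" using x by (rule analytic_at_imp_isCont)
  hence "filterlim x (nhds 1) (nhds 0)"
    using deriv_local_inverse_cubic(2) by (simp add: isCont_def tendsto_nhds_iff x_def)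
  \<comment> \<open>The values 0 and -2 are the zeros of the factors to be cancelled; x(0) = 1 keeps
    x away from both.\<close>
  hence nz: "\<forall>\<^sub>F u in nhds 0. x u \<noteq> 0" "\<forall>\<^sub>F u in nhds 0. x u \<noteq> -2"
    by (auto intro: tendsto_imp_eventually_ne)
  have kl: "k\<^sup>2 = 1 - (of_real lam)\<^sup>2"
    using assms unfolding k_def by (metis add_diff_cancel_right' of_real_1 of_real_diff of_real_power)
  have "\<forall>\<^sub>F u in nhds 0. 9 * (deriv x u)\<^sup>2 = 4 * (1 - x u) * (x u ^ 3 + 3 * (x u)\<^sup>2 - 4 * (of_real lam)\<^sup>2)"
    using nz ev cub eventually_analytic_nhds[OF \<phi>] eventually_analytic_nhds[OF x]
  proof eventually_elim
    case (elim u)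
    have Dx: "(x has_field_derivative deriv x u) (at u)"
      using elim(6) analytic_derivI by blast
    have D\<phi>: "(\<phi> has_field_derivative x u) (at u)"
      unfolding x_def using elim(5) analytic_derivI by blast
    define s c where "s = sin (\<phi> u)" and "c = cos (\<phi> u)"
    have "((\<lambda>v. x v ^ 3 + 3 * (x v)\<^sup>2) has_field_derivative (3 * (x u)\<^sup>2 + 6 * x u) * deriv x u) (at u)"
      by (auto intro!: derivative_eq_intros Dx simp: algebra_simps)
    moreover have "((\<lambda>v. 4 * (1 - k\<^sup>2 * (sin (\<phi> v))\<^sup>2)) has_field_derivative (- 8 * k\<^sup>2 * s * c * x u)) (at u)"
      by (auto intro!: derivative_eq_intros D\<phi> simp: algebra_simps s_def c_def)
    hence "((\<lambda>v. x v ^ 3 + 3 * (x v)\<^sup>2) has_field_derivative (- 8 * k\<^sup>2 * s * c * x u)) (at u)"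
      using DERIV_cong_ev[OF refl elim(3) refl] by blast
    ultimately have "(3 * (x u)\<^sup>2 + 6 * x u) * deriv x u = - 8 * k\<^sup>2 * s * c * x u"
      by (rule DERIV_unique)
    hence "x u * (3 * (x u + 2) * deriv x u) = x u * (- 8 * k\<^sup>2 * s * c)"
      by (simp add: algebra_simps power2_eq_square)
    hence "3 * (x u + 2) * deriv x u = - 8 * k\<^sup>2 * s * c" by (rule mult_left_cancel[OF elim(1), THEN iffD1])
    hence "(3 * (x u + 2) * deriv x u)\<^sup>2 = (- 8 * k\<^sup>2 * s * c)\<^sup>2" by simp
    hence 1: "(x u + 2)\<^sup>2 * (9 * (deriv x u)\<^sup>2) = 4 * (4 * (k\<^sup>2 * s\<^sup>2)) * (4 * (k\<^sup>2 - k\<^sup>2 * s\<^sup>2))"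
      using sin_cos_squared_add[of "\<phi> u"] unfolding s_def[symmetric] c_def[symmetric] by algebra
    \<comment> \<open>This is the factorization 4 - x^3 - 3x^2 = (1 - x)(x + 2)^2, the source of the
      factor that cancels.\<close>
    have 2: "4 * (k\<^sup>2 * s\<^sup>2) = (1 - x u) * (x u + 2)\<^sup>2"
      using elim(4) unfolding s_def by algebra
    have 3: "4 * (k\<^sup>2 - k\<^sup>2 * s\<^sup>2) = x u ^ 3 + 3 * (x u)\<^sup>2 - 4 * (of_real lam)\<^sup>2"
      using elim(4) kl unfolding s_def by algebra
    have "(x u + 2)\<^sup>2 * (9 * (deriv x u)\<^sup>2) = (x u + 2)\<^sup>2 *
        (4 * (1 - x u) * (x u ^ 3 + 3 * (x u)\<^sup>2 - 4 * (of_real lam)\<^sup>2))"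
      unfolding 1 2 3 by algebra
    moreover have "(x u + 2)\<^sup>2 \<noteq> 0" using elim(2) by (simp add: add_eq_0_iff2)
    ultimately show ?case by (simp only: mult_cancel_left simp_thms)
  qed
  thus ?thesis by (simp add: x_def)
qed

text \<open>The value 1 would force sin (\<phi> u) = 0 by the cubic relation, hence \<phi> u = 0
  close to 0, and \<phi> is injective there. This permits division by 1 - \<phi>'.\<close>

lemma deriv_local_inverse_ne_1:
  assumes "\<kappa> \<noteq> 0"
  shows "\<forall>\<^sub>F u in at 0. deriv \<phi> u \<noteq> 1"
proof -
  have \<phi>: "\<phi> analytic_on {0}" "\<phi> 0 = 0" "\<forall>\<^sub>F u in nhds 0. dn3_integral \<kappa> (\<phi> u) = u"
    using inv by (auto simp: analytic_local_inverse_0_def)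
  have lim: "filterlim \<phi> (nhds 0) (nhds 0)"
    using analytic_at_imp_isCont[OF \<phi>(1)] \<phi>(2) by (simp add: isCont_def tendsto_nhds_iff)
  \<comment> \<open>The only zero of the sine in this disc is 0.\<close>
  have "\<forall>\<^sub>F T in nhds (0::complex). T \<in> ball 0 pi"
    by (intro eventually_nhds_in_open) auto
  hence "\<forall>\<^sub>F u in nhds 0. \<phi> u \<in> ball 0 pi"
    using lim by (rule eventually_compose_filterlim)
  hence "\<forall>\<^sub>F u in nhds 0. u \<noteq> 0 \<longrightarrow> deriv \<phi> u \<noteq> 1"
    using \<phi>(3) deriv_local_inverse_cubic(1)
  proof eventually_elim
    case (elim u)
    show ?case
    proof (intro impI notI)
      assume u: "u \<noteq> 0" "deriv \<phi> u = 1"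
      hence "sin (\<phi> u) = 0" using elim(3) assms by simp
      then obtain n :: int where n: "\<phi> u = of_real (of_int n * pi)"
        by (auto simp: sin_eq_0)
      hence "\<bar>of_int n\<bar> * pi < 1 * pi" using elim(1) by (simp add: abs_mult del: of_real_mult)
      hence "n = 0" by (simp add: mult_less_cancel_right)
      hence "\<phi> u = 0" using n by simp
      thus False using u elim(2) eventually_nhds_x_imp_x[OF \<phi>(3)] \<phi>(2) by simp
    qed
  qed
  thus ?thesis by (simp add: eventually_at_filter)
qed

end

subsection \<open>Values at the half-periods\<close>

lemma mult_one_minus_one_minus_divide:
  fixes a c :: "'a :: field"
  assumes "a \<noteq> 0"
  shows "a * (1 - (1 - c / a)) = c"
  using assms by simp

text \<open>The substitution \<open>p = (4/9) k / t - 1/3\<close> with \<open>k = \<kappa>\<^sup>2\<close>, \<open>l = \<lambda>\<^sup>2\<close> and \<open>t = 1 - x\<close> turns the Weierstrass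
  cubic in \<open>p\<close> into a multiple of the cubic \<open>g(x)\<close>.\<close>

lemma weierstrass_cubic_dn3_cubic:
  fixes p t k l :: "'a :: field_char_0"
  assumes "k = 1 - l" "(1 / 3 + p) * t = 4 / 9 * k"
  shows "t ^ 3 * (4 * p ^ 3 - 4 / 27 * (1 + 8 * l) * p - 8 / 729 * (8 * l\<^sup>2 + 20 * l - 1)) =
    64 / 729 * k\<^sup>2 * ((1 - t) ^ 3 + 3 * (1 - t)\<^sup>2 - 4 * l)"
proof -
  \<comment> \<open>Multiplying by t^3 homogenizes the cubic, so \<open>p\<close> occurs only
    through p t, which is affine in \<open>t\<close>.\<close>
  define q where "q = p * t"
  have q: "q = 4 / 9 * k - t / 3"
    using assms(2) by (simp add: q_def algebra_simps)
  have "t ^ 3 * (4 * p ^ 3 - 4 / 27 * (1 + 8 * l) * p - 8 / 729 * (8 * l\<^sup>2 + 20 * l - 1)) =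
    4 * q ^ 3 - 4 / 27 * (1 + 8 * l) * q * t\<^sup>2 - 8 / 729 * (8 * l\<^sup>2 + 20 * l - 1) * t ^ 3"
    by (simp add: q_def algebra_simps power2_eq_square power3_eq_cube)
  also have "\<dots> = 64 / 729 * k\<^sup>2 * ((1 - t) ^ 3 + 3 * (1 - t)\<^sup>2 - 4 * l)"
    unfolding q assms(1) by (simp add: field_simps power2_eq_square power3_eq_cube)
  finally show ?thesis .
qed

lemma of_real_dn3_invariants:
  "complex_of_real (dn3_g2 lam) = 4 / 27 * (1 + 8 * (of_real lam)\<^sup>2)"
  "complex_of_real (dn3_g3 lam) = 8 / 729 * (8 * ((of_real lam)\<^sup>2)\<^sup>2 + 20 * (of_real lam)\<^sup>2 - 1)"
  by (simp_all add: dn3_g2_def dn3_g3_def flip: power_mult)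

section \<open>Behaviour of Weierstrass functions on the real axis\<close>

text \<open>The explicit bound makes 4p^3 dominate the lower terms. It serves to exclude large
  negative values of \<open>P\<close> on the real axis.\<close>

lemma weierstrass_cubic_neg:
  fixes g2 g3 p :: real
  assumes "p \<le> - (1 + \<bar>g2\<bar> + \<bar>g3\<bar>)"
  shows "4 * p ^ 3 - g2 * p - g3 < 0"
proof -
  define q where "q = - p"
  have q: "q \<ge> 1 + \<bar>g2\<bar> + \<bar>g3\<bar>" using assms by (simp add: q_def)
  hence q1: "q \<ge> 1" by linarith
  have "g2 * q \<le> \<bar>g2\<bar> * q" using q1 by (intro mult_right_mono) auto
  moreover have "- g3 \<le> \<bar>g3\<bar> * q" using q1 mult_left_mono[of 1 q "\<bar>g3\<bar>"] by linarith
  moreover have "(\<bar>g2\<bar> + \<bar>g3\<bar>) * q < q * q" using q q1 by (intro mult_strict_right_mono) linarith+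
  moreover have "q * q * 1 \<le> q * q * q" using q1 by (intro mult_left_mono) auto
  moreover have "q * q * q > 0" using q1 by simp
  ultimately have "- 4 * (q * q * q) + g2 * q - g3 < 0" by (simp add: algebra_simps)
  thus ?thesis by (simp add: q_def power3_eq_cube)
qed

lemma weierstrass_function_real:
  assumes "weierstrass_function (of_real g2) (of_real g3) P"
  shows "P (of_real t) = of_real (Re (P (of_real t)))"
  using weierstrass_function_cnj[OF assms, of "of_real t"]
  by (metis complex_cnj_complex_of_real complex_is_Real_iff of_real_Re Reals_cnj_iff)

text \<open>The cubic equals the square of P'(t), and P'(t) is real because \<open>P\<close>
  commutes with conjugation.\<close>

lemma weierstrass_function_real_cubic_nonneg:
  assumes P: "weierstrass_function (of_real g2) (of_real g3) P" and "of_real t \<notin> periods P"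
  defines "p \<equiv> Re (P (of_real t))"
  shows "4 * p ^ 3 - g2 * p - g3 \<ge> 0"
proof -
  have np: "\<not> is_pole P (of_real t)" using weierstrass_function_pole_is_period assms by blast
  hence ana: "P analytic_on {of_real t}" using weierstrass_function_analytic P by blast
  have D: "(P has_field_derivative deriv P (of_real t)) (at (of_real t))"
    using ana analytic_derivI by blast
  have "cnj \<circ> P \<circ> cnj = P"
    using weierstrass_function_cnj[OF P] by (simp add: fun_eq_iff)
  moreover have "((cnj \<circ> P \<circ> cnj) has_field_derivative cnj (deriv P (of_real t))) (at (of_real t))"
    by (rule has_field_derivative_cnj_cnj) (use D in simp)
  ultimately have "cnj (deriv P (of_real t)) = deriv P (of_real t)"
    using D by (auto intro: DERIV_unique)
  then obtain d where d: "deriv P (of_real t) = of_real d"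
    by (metis Reals_cnj_iff Reals_cases)
  have "(deriv P (of_real t))\<^sup>2 = 4 * P (of_real t) ^ 3 - of_real g2 * P (of_real t) - of_real g3"
    using P np by (auto simp: weierstrass_function_def)
  hence "of_real (d\<^sup>2) = (of_real (4 * p ^ 3 - g2 * p - g3) :: complex)"
    using weierstrass_function_real[OF P, of t] unfolding d p_def by simp
  hence "d\<^sup>2 = 4 * p ^ 3 - g2 * p - g3" by (simp only: of_real_eq_iff)
  thus ?thesis by (metis zero_le_power2)
qed

text \<open>\<open>P\<close> cannot cross the value \<open>m\<close>, since the cubic equals the square of the real number \<open>deriv P t\<close>.\<close>

lemma weierstrass_function_real_gt:
  assumes P: "weierstrass_function (of_real g2) (of_real g3) P" and "0 < K"
    and np: "\<And>t. 0 < t \<Longrightarrow> t \<le> K \<Longrightarrow> of_real t \<notin> periods P"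
    and m: "4 * m ^ 3 - g2 * m - g3 < 0"
  shows "Re (P (of_real K)) > m"
proof (rule ccontr)
  assume le: "\<not> Re (P (of_real K)) > m"
  define p where "p = (\<lambda>t. Re (P (complex_of_real t)))"
  have nonneg: "4 * p t ^ 3 - g2 * p t - g3 \<ge> 0" if "0 < t" "t \<le> K" for t
    unfolding p_def using weierstrass_function_real_cubic_nonneg[OF P np[OF that]] .
  \<comment> \<open>If the absolute value of p is at least \<open>M\<close>, then either p lies
    above m or p is so negative that \<open>weierstrass_cubic_neg\<close> applies.\<close>
  define M where "M = 1 + \<bar>g2\<bar> + \<bar>g3\<bar> + \<bar>m\<bar>"
  have "filterlim complex_of_real (at 0) (at_right 0)"
    by (auto simp: filterlim_at eventually_at_filter intro!: tendsto_eq_intros)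
  moreover have "filterlim P at_infinity (at 0)"
    using P by (simp add: weierstrass_function_def is_pole_def)
  ultimately have "filterlim (\<lambda>t. P (complex_of_real t)) at_infinity (at_right 0)"
    using filterlim_compose by blast
  hence "\<forall>\<^sub>F t in at_right 0. norm (P (complex_of_real t)) \<ge> M"
    by (subst (asm) filterlim_at_infinity[of 0]) (auto simp: M_def)
  moreover have "\<forall>\<^sub>F t in at_right 0. t \<in> {0<..<K}"
    using \<open>0 < K\<close> by (rule eventually_at_right_real)
  ultimately have "\<forall>\<^sub>F t in at_right 0. norm (P (complex_of_real t)) \<ge> M \<and> t \<in> {0<..<K}"
    by (rule eventually_conj)
  then obtain t0 where t0: "norm (P (complex_of_real t0)) \<ge> M" "0 < t0" "t0 < K"
    using eventually_happens'[OF trivial_limit_at_right_real] by fastforce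
  have "\<bar>p t0\<bar> \<ge> M"
    using t0(1) weierstrass_function_real[OF P, of t0] unfolding p_def by (metis norm_of_real)
  moreover have "\<not> p t0 \<le> - M"
  proof
    assume "p t0 \<le> - M"
    hence "p t0 \<le> - (1 + \<bar>g2\<bar> + \<bar>g3\<bar>)" by (simp add: M_def)
    from weierstrass_cubic_neg[OF this] nonneg[of t0] t0 show False by simp
  qed
  ultimately have "p t0 \<ge> m" by (auto simp: M_def)
  moreover have "continuous_on {t0..K} p"
  proof (rule continuous_at_imp_continuous_on, intro ballI)
    fix t assume t: "t \<in> {t0..K}"
    hence "P analytic_on {of_real t}"
      using np[of t] t0 weierstrass_function_pole_is_period[OF P] weierstrass_function_analytic[OF P] by auto
    hence "isCont P (of_real t)" by (rule analytic_at_imp_isCont)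
    moreover have "isCont complex_of_real t" by simp
    ultimately have "isCont (\<lambda>t. P (of_real t)) t" by (rule isCont_o2[rotated])
    thus "isCont p t" unfolding p_def by (rule isCont_Re)
  qed
  moreover have "p K \<le> m" using le by (simp add: p_def)
  \<comment> \<open>By the intermediate value theorem \<open>p\<close> takes the value
    \<open>m\<close>, where the cubic is negative.\<close>
  ultimately obtain t where t: "t0 \<le> t" "t \<le> K" "p t = m"
    using IVT2'[of p K m t0] t0(3) by auto
  show False using nonneg[of t] t t0 m by simp
qed

section \<open>Relation between the Weierstrass function and \<open>dn\<^sub>3\<close>\<close>

text \<open>Solving the relation for \<open>P\<close> suggests the candidate \<open>Q\<close>. It
  has a pole at 0 because \<phi>'(0) = 1, and the differential equation of \<phi>' becomes the
  Weierstrass equation of \<open>Q\<close>; germ uniqueness identifies it with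
  \<open>P\<close>.\<close>

lemma dn3_weierstrass_at_0:
  fixes \<kappa> lam :: real
  assumes inv: "analytic_local_inverse_0 (dn3_integral \<kappa>) \<phi>"
    and kl: "\<kappa>\<^sup>2 + lam\<^sup>2 = 1" and "\<kappa> \<noteq> 0"
    and P: "weierstrass_function (of_real (dn3_g2 lam)) (of_real (dn3_g3 lam)) P"
  shows "\<forall>\<^sub>F u in at 0. (1 / 3 + P u) * (1 - deriv \<phi> u) = 4 / 9 * (of_real \<kappa>)\<^sup>2"
proof -
  define x where "x = deriv \<phi>"
  define k l where "k = (complex_of_real \<kappa>)\<^sup>2" and "l = (complex_of_real lam)\<^sup>2"
  define Q where "Q = (\<lambda>u. 4 / 9 * k / (1 - x u) - 1 / 3)"
  have k: "k = 1 - l" "k \<noteq> 0"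
    using kl \<open>\<kappa> \<noteq> 0\<close> unfolding k_def l_def
    by (metis add_diff_cancel_right' of_real_1 of_real_diff of_real_power, simp)
  note g = of_real_dn3_invariants[of lam, folded l_def]
  have "\<phi> analytic_on {0}" using inv by (simp add: analytic_local_inverse_0_def)
  hence x: "x analytic_on {0}" unfolding x_def by (rule analytic_deriv)
  have x1: "\<forall>\<^sub>F u in at 0. x u \<noteq> 1"
    unfolding x_def by (rule deriv_local_inverse_ne_1[OF inv \<open>\<kappa> \<noteq> 0\<close>])
  have Q_mero: "Q meromorphic_on {0}"
    unfolding Q_def using analytic_on_imp_meromorphic_on[OF x] by (intro meromorphic_intros)
  have "x \<midarrow>0\<rightarrow> 1"
    using isContD[OF analytic_at_imp_isCont[OF x]] deriv_local_inverse_cubic(2)[OF inv] by (simp add: x_def)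
  hence "(\<lambda>u. 1 - x u) \<midarrow>0\<rightarrow> 0"
    by (auto intro!: tendsto_eq_intros)
  hence "filterlim (\<lambda>u. 1 - x u) (at 0) (at 0)"
    using x1 by (simp add: filterlim_at eventually_mono)
  hence "filterlim (\<lambda>u. 4 / 9 * k / (1 - x u)) at_infinity (at 0)"
    by (rule filterlim_divide_at_infinity[OF tendsto_const]) (use k(2) in auto)
  hence pole: "is_pole Q 0"
    unfolding Q_def is_pole_minus_const_iff unfolding is_pole_def .
  have "\<forall>\<^sub>F u in at 0. 9 * (deriv x u)\<^sup>2 = 4 * (1 - x u) * (x u ^ 3 + 3 * (x u)\<^sup>2 - 4 * l)"
    using deriv_local_inverse_ode[OF inv kl] unfolding x_def l_def
    by (rule filter_leD[OF at_within_le_nhds])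
  moreover have "\<forall>\<^sub>F u in at 0. x analytic_on {u}"
    using eventually_analytic_nhds[OF x] by (rule filter_leD[OF at_within_le_nhds])
  ultimately have Q_ode: "\<forall>\<^sub>F u in at 0. (deriv Q u)\<^sup>2 = 4 * Q u ^ 3 - of_real (dn3_g2 lam) * Q u - of_real (dn3_g3 lam)"
    using x1
  proof eventually_elim
    case (elim u)
    define t where "t = 1 - x u"
    have t: "t \<noteq> 0" and xu: "x u = 1 - t" using elim(3) by (simp_all add: t_def)
    have "(x has_field_derivative deriv x u) (at u)"
      using elim(2) analytic_derivI by blast
    hence "((\<lambda>u. c / (1 - x u) - 1 / 3) has_field_derivative c * deriv x u / t\<^sup>2) (at u)" for c
      using t by (auto intro!: derivative_eq_intros simp: t_def power2_eq_square)
    hence "(Q has_field_derivative 4 / 9 * k * deriv x u / t\<^sup>2) (at u)"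
      unfolding Q_def .
    hence dQ: "deriv Q u = 4 / 9 * k * deriv x u / t\<^sup>2" by (rule DERIV_imp_deriv)
    have "t ^ 3 * (deriv Q u)\<^sup>2 = 16 / 729 * k\<^sup>2 * (9 * (deriv x u)\<^sup>2) / t"
      unfolding dQ using t by (simp add: field_simps eval_nat_numeral)
    also have "\<dots> = 64 / 729 * k\<^sup>2 * ((1 - t) ^ 3 + 3 * (1 - t)\<^sup>2 - 4 * l)"
      unfolding elim(1) xu using t by simp
    also have "\<dots> = t ^ 3 * (4 * Q u ^ 3 - 4 / 27 * (1 + 8 * l) * Q u - 8 / 729 * (8 * l\<^sup>2 + 20 * l - 1))"
      using t by (intro weierstrass_cubic_dn3_cubic[OF k(1), symmetric]) (simp add: Q_def xu field_simps)
    finally show ?case unfolding g using t by simp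
  qed
  have P_mero: "P meromorphic_on {0}" "is_pole P 0"
    using P by (auto simp: weierstrass_function_def nicely_meromorphic_on_def intro: meromorphic_on_subset)
  have P_ode: "\<forall>\<^sub>F u in at 0. (deriv P u)\<^sup>2 = 4 * P u ^ 3 - of_real (dn3_g2 lam) * P u - of_real (dn3_g3 lam)"
    using weierstrass_function_ode_at[OF P] by eventually_elim simp
  have "\<forall>\<^sub>F u in at 0. P u = Q u"
    by (rule weierstrass_germ_unique[OF P_mero P_ode Q_mero pole Q_ode])
  thus ?thesis using x1
  proof eventually_elim
    case (elim u)
    have "(1 / 3 + (c / t - 1 / 3)) * t = c" if "t \<noteq> 0" for c t :: complex
      using that by simp
    thus ?case using elim by (simp add: Q_def flip: x_def k_def del: divide_divide_eq_left times_divide_eq_left)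
  qed
qed

text \<open>The relation near 0 carries over to \<open>h\<close> by the identity theorem. There P'
  vanishes, so the derivative of \<open>dn\<close> vanishes too, and the root of the Weierstrass
  cubic becomes a root of g.\<close>

lemma dn3_at_half_period:
  fixes \<kappa> lam :: real
  assumes inv: "analytic_local_inverse_0 (dn3_integral \<kappa>) \<phi>"
    and kl: "\<kappa>\<^sup>2 + lam\<^sup>2 = 1" and "\<kappa> \<noteq> 0"
    and dn: "dn nicely_meromorphic_on UNIV" "\<forall>\<^sub>F u in nhds 0. dn u = deriv \<phi> u"
    and P: "weierstrass_function (of_real (dn3_g2 lam)) (of_real (dn3_g3 lam)) P"
    and h: "2 * h \<in> periods P" "h \<notin> periods P"
  shows "(dn has_field_derivative 0) (at h)"
    and "(1 / 3 + P h) * (1 - dn h) = 4 / 9 * (of_real \<kappa>)\<^sup>2"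
    and "dn h ^ 3 + 3 * (dn h)\<^sup>2 = 4 * (of_real lam)\<^sup>2"
proof -
  define k l where "k = (complex_of_real \<kappa>)\<^sup>2" and "l = (complex_of_real lam)\<^sup>2"
  have k: "k = 1 - l" "k \<noteq> 0"
    using kl \<open>\<kappa> \<noteq> 0\<close> unfolding k_def l_def
    by (metis add_diff_cancel_right' of_real_1 of_real_diff of_real_power, simp)
  note g = of_real_dn3_invariants[of lam, folded l_def]
  have ana: "P analytic_on {h}" and dP: "deriv P h = 0"
    and root: "4 * P h ^ 3 - 4 / 27 * (1 + 8 * l) * P h - 8 / 729 * (8 * l\<^sup>2 + 20 * l - 1) = 0"
    using weierstrass_function_half_period[OF P h] by (simp_all only: g)
  \<comment> \<open>At -1/3 the Weierstrass cubic takes the nonzero value -64 \<kappa>^4 / 729, so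
    \<open>P h\<close> cannot be -1/3 and \<open>dn\<close> has no pole at \<open>h\<close>.\<close>
  have ne: "1 / 3 + P h \<noteq> 0"
  proof
    assume "1 / 3 + P h = 0"
    hence "P h = - 1 / 3" by (simp add: add_eq_0_iff)
    have "64 / 729 * k\<^sup>2 = - (4 * P h ^ 3 - 4 / 27 * (1 + 8 * l) * P h - 8 / 729 * (8 * l\<^sup>2 + 20 * l - 1))"
      unfolding k(1) \<open>P h = - 1 / 3\<close> by (simp add: field_simps power2_eq_square power3_eq_cube)
    thus False unfolding root using k(2) by simp
  qed
  have mero: "P meromorphic_on UNIV" "dn meromorphic_on UNIV"
    using P dn by (auto simp: weierstrass_function_def nicely_meromorphic_on_def)
  have "\<forall>\<^sub>F u in at 0. (1 / 3 + P u) * (1 - dn u) = 4 / 9 * k"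
    using dn3_weierstrass_at_0[OF inv kl \<open>\<kappa> \<noteq> 0\<close> P] filter_leD[OF at_within_le_nhds dn(2)]
    unfolding k_def by eventually_elim simp
  \<comment> \<open>In product form both sides are meromorphic on the whole plane.\<close>
  hence rel: "\<forall>\<^sub>F u in at h. (1 / 3 + P u) * (1 - dn u) = 4 / 9 * k"
    by (rule meromorphic_eq_at_propagate[rotated 2]) (intro meromorphic_intros mero)+
  define R where "R = (\<lambda>u. 1 - 4 / 9 * k / (1 / 3 + P u))"
  have "(\<lambda>u. 1 / 3 + P u) \<midarrow>h\<rightarrow> 1 / 3 + P h"
    using isContD[OF analytic_at_imp_isCont[OF ana]] by (intro tendsto_intros)
  hence "\<forall>\<^sub>F u in at h. 1 / 3 + P u \<noteq> 0"
    using ne by (rule tendsto_imp_eventually_ne)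
  hence eq: "\<forall>\<^sub>F u in at h. dn u = R u"
    using rel
  proof eventually_elim
    case (elim u)
    hence "4 / 9 * k / (1 / 3 + P u) = 1 - dn u" by (metis nonzero_mult_div_cancel_left)
    thus ?case by (simp add: R_def)
  qed
  have R: "R analytic_on {h}"
    unfolding R_def using ne by (intro analytic_intros ana) auto
  have dnh: "dn h = R h"
    by (rule nicely_meromorphic_eq_at[OF nicely_meromorphic_on_subset[OF dn(1)]
          analytic_on_imp_nicely_meromorphic_on[OF R] eq]) simp
  hence ev: "\<forall>\<^sub>F u in nhds h. dn u = R u"
    using eq unfolding eventually_at_filter by (auto elim!: eventually_mono)
  have "(P has_field_derivative 0) (at h)"
    using analytic_derivI[OF ana] by (simp add: dP)
  hence "((\<lambda>u. 1 - c / (1 / 3 + P u)) has_field_derivative 0) (at h)" for c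
    using ne by (auto intro!: derivative_eq_intros)
  hence "(R has_field_derivative 0) (at h)"
    unfolding R_def .
  thus "(dn has_field_derivative 0) (at h)"
    using DERIV_cong_ev[OF refl ev refl] by blast
  have "(1 / 3 + P h) * (1 - dn h) = 4 / 9 * k"
    unfolding dnh R_def by (rule mult_one_minus_one_minus_divide[OF ne])
  thus "(1 / 3 + P h) * (1 - dn h) = 4 / 9 * (of_real \<kappa>)\<^sup>2" by (simp add: k_def)
  have "64 / 729 * k\<^sup>2 * ((1 - (1 - dn h)) ^ 3 + 3 * (1 - (1 - dn h))\<^sup>2 - 4 * l) = 0"
    using weierstrass_cubic_dn3_cubic[OF k(1) \<open>(1 / 3 + P h) * (1 - dn h) = 4 / 9 * k\<close>]
    unfolding root by simp
  thus "dn h ^ 3 + 3 * (dn h)\<^sup>2 = 4 * (of_real lam)\<^sup>2"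
    using k(2) by (simp add: l_def)
qed

section \<open>The positive root of the cubic and its trigonometric form\<close>

lemma dn3_cubic_strict_mono:
  assumes "0 < x" "x < y"
  shows "dn3_cubic lam x < dn3_cubic lam y"
proof -
  have "x ^ 3 < y ^ 3" "x\<^sup>2 < y\<^sup>2" using assms by (auto intro!: power_strict_mono)
  thus ?thesis by (simp add: dn3_cubic_def)
qed

lemma dn3_cubic_root_unique:
  assumes "0 < x" "0 < y" "dn3_cubic lam x = 0" "dn3_cubic lam y = 0"
  shows "x = y"
  using assms dn3_cubic_strict_mono by (metis less_irrefl linorder_neqE_linordered_idom)

theorem theorem5:
  fixes \<kappa> lam \<theta> x\<^sub>1 K K' :: real
    and \<phi> dn\<^sub>3 P :: "complex \<Rightarrow> complex"
  assumes "0 < \<kappa>" "\<kappa> < 1" "0 < lam" "lam < 1" "\<kappa>\<^sup>2 + lam\<^sup>2 = 1"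
    and "0 < \<theta>" "\<theta> < pi / 6" "lam = cos (3 * \<theta>)"
    and "0 < x\<^sub>1" "x\<^sub>1 < 1" "dn3_cubic lam x\<^sub>1 = 0"
    and "analytic_local_inverse_0 (dn3_integral \<kappa>) \<phi>"
    and "elliptic_function dn\<^sub>3" "\<forall>\<^sub>F u in nhds 0. dn\<^sub>3 u = deriv \<phi> u"
    and "weierstrass_function (of_real (dn3_g2 lam)) (of_real (dn3_g3 lam)) P"
    and "0 < K" "0 < K'" "periods P = rectangular_lattice K K'"
  shows "(\<exists>!x. 0 < x \<and> x < 1 \<and> dn3_cubic lam x = 0) \<and>
    critical_values_at dn\<^sub>3 {of_real K, of_real K + \<i> * of_real K', \<i> * of_real K'}
      \<inter> of_real ` {0<..} = {dn\<^sub>3 (of_real K)} \<and>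
    dn\<^sub>3 (of_real K) = of_real x\<^sub>1 \<and>
    x\<^sub>1 = 4 * (cos \<theta>)\<^sup>2 - 3 \<and>
    4 * (cos \<theta>)\<^sup>2 - 3 = 2 * cos (2 * \<theta>) - 1"
proof -
  note P = assms(15)
  define H where "H = {of_real K, of_real K + \<i> * of_real K', \<i> * complex_of_real K'}"
  have per: "z \<in> periods P \<longleftrightarrow> (\<exists>m n :: int. Re z = 2 * of_int m * K \<and> Im z = 2 * of_int n * K')" for z
    unfolding assms(18) rectangular_lattice_def by (auto simp: complex_eq_iff)
  \<comment> \<open>Were a nonzero half-period a period, comparing its coordinates with the lattice
    would make 1 an even integer.\<close>
  have odd: "(1 :: real) \<noteq> 2 * of_int m" for m :: int
  proof
    assume "(1 :: real) = 2 * of_int m"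
    hence "real_of_int 1 = of_int (2 * m)" by simp
    hence "1 = 2 * m" by (simp only: of_int_eq_iff)
    thus False by presburger
  qed
  have half: "2 * h \<in> periods P" "h \<notin> periods P" if "h \<in> H" for h
  proof -
    show "2 * h \<in> periods P"
      using that unfolding per H_def
      by (auto intro: exI[of _ 0] exI[of _ 1])
    show "h \<notin> periods P"
      using that odd assms(16,17) unfolding per H_def by auto
  qed
  have "dn\<^sub>3 nicely_meromorphic_on UNIV"
    using assms(13) by (simp add: elliptic_function_def)
  note dn = dn3_at_half_period[OF assms(12,5) _ this assms(14) P half]
  have crit: "(dn\<^sub>3 has_field_derivative 0) (at h)" if "h \<in> H" for h
    using dn(1) that assms(1) by simp
  \<comment> \<open>This serves twice: it identifies the value at \<open>K\<close> once that is
    known to be positive, and it shows that any positive value at another half-period would coincide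
    with it.\<close>
  have root: "x = x\<^sub>1" if "h \<in> H" "dn\<^sub>3 h = of_real x" "0 < x" for h x
  proof -
    have "complex_of_real (x ^ 3 + 3 * x\<^sup>2) = of_real (4 * lam\<^sup>2)"
      using dn(3)[OF _ that(1) that(1)] assms(1) that(2) by simp
    hence "dn3_cubic lam x = 0" by (simp only: of_real_eq_iff dn3_cubic_def)
    thus ?thesis using dn3_cubic_root_unique assms(9,11) that(3) by blast
  qed
  have KH: "of_real K \<in> H" by (simp add: H_def)
  define p where "p = Re (P (of_real K))"
  \<comment> \<open>This value of \<open>P\<close> corresponds to x = 0, that is t = 1 in the
    substitution, where g(0) = -4 \<lambda>^2 is negative.\<close>
  define m where "m = 4 / 9 * \<kappa>\<^sup>2 - 1 / 3"
  have "p > m"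
    unfolding p_def
  proof (rule weierstrass_function_real_gt[OF P \<open>0 < K\<close>])
    fix t assume t: "0 < t" "t \<le> K"
    show "of_real t \<notin> periods P"
    proof
      assume "of_real t \<in> periods P"
      then obtain n :: int where n: "t = 2 * of_int n * K" unfolding per by auto
      have "0 < of_int n * K" "of_int n * K < 1 * K" using t n assms(16) by linarith+
      hence "0 < n" "n < 1" using assms(16) by (simp_all add: zero_less_mult_iff mult_less_cancel_right)
      thus False by simp
    qed
  next
    have "4 * m ^ 3 - dn3_g2 lam * m - dn3_g3 lam = 64 / 729 * (\<kappa>\<^sup>2)\<^sup>2 * (- 4 * lam\<^sup>2)"
      using weierstrass_cubic_dn3_cubic[of "\<kappa>\<^sup>2" "lam\<^sup>2" m 1] assms(5)
      by (simp add: dn3_g2_def dn3_g3_def m_def flip: power_mult)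
    also have "\<dots> < 0" using assms(1,3) by simp
    finally show "4 * m ^ 3 - dn3_g2 lam * m - dn3_g3 lam < 0" .
  qed
  \<comment> \<open>The relation solved for the value at \<open>K\<close>, over the reals; p > m
    says exactly that the denominator exceeds the numerator, so x is positive.\<close>
  define x where "x = 1 - 4 / 9 * \<kappa>\<^sup>2 / (1 / 3 + p)"
  have p: "1 / 3 + p > 4 / 9 * \<kappa>\<^sup>2" using \<open>p > m\<close> by (simp add: m_def)
  moreover have k: "4 / 9 * \<kappa>\<^sup>2 > 0" using assms(1) by simp
  ultimately have "1 / 3 + p > 0" by linarith
  have "x > 0" using p \<open>1 / 3 + p > 0\<close> divide_less_eq_1_pos by (simp add: x_def)
  have "P (of_real K) = of_real p" unfolding p_def by (rule weierstrass_function_real[OF P])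
  hence "of_real (1 / 3 + p) * (1 - dn\<^sub>3 (of_real K)) = of_real (4 / 9 * \<kappa>\<^sup>2)"
    using dn(2)[OF _ KH KH] assms(1) by simp
  also have "4 / 9 * \<kappa>\<^sup>2 = (1 / 3 + p) * (1 - x)"
    unfolding x_def using \<open>1 / 3 + p > 0\<close> mult_one_minus_one_minus_divide by (metis less_irrefl)
  finally have "of_real (1 / 3 + p) * (1 - dn\<^sub>3 (of_real K)) = of_real (1 / 3 + p) * (1 - of_real x)"
    by (simp only: of_real_mult of_real_diff of_real_1)
  hence dnx: "dn\<^sub>3 (of_real K) = of_real x" using \<open>1 / 3 + p > 0\<close>
    by (metis mult_left_cancel of_real_eq_0_iff less_irrefl diff_left_imp_eq)
  hence x: "dn\<^sub>3 (of_real K) = of_real x\<^sub>1" using root[OF KH dnx \<open>x > 0\<close>] by simp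
  have "critical_values_at dn\<^sub>3 H \<inter> of_real ` {0<..} = {dn\<^sub>3 (of_real K)}"
  proof (intro equalityI subsetI)
    fix v assume "v \<in> critical_values_at dn\<^sub>3 H \<inter> of_real ` {0<..}"
    then obtain h x where "h \<in> H" "v = dn\<^sub>3 h" "v = of_real x" "0 < x"
      unfolding critical_values_at_def by blast
    thus "v \<in> {dn\<^sub>3 (of_real K)}" using root[of h x] x by simp
  next
    fix v assume "v \<in> {dn\<^sub>3 (of_real K)}"
    thus "v \<in> critical_values_at dn\<^sub>3 H \<inter> of_real ` {0<..}"
      using crit[OF KH] KH x assms(9) unfolding critical_values_at_def by blast
  qed
  moreover have "\<exists>!x. 0 < x \<and> x < 1 \<and> dn3_cubic lam x = 0"
    using assms(9-11) dn3_cubic_root_unique by blast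
  moreover have dbl: "4 * (cos \<theta>)\<^sup>2 - 3 = 2 * cos (2 * \<theta>) - 1"
    by (simp add: cos_double_cos)
  moreover have "x\<^sub>1 = 4 * (cos \<theta>)\<^sup>2 - 3"
  proof (rule dn3_cubic_root_unique[OF assms(9) _ assms(11)])
    \<comment> \<open>Positivity of 2 cos 2\<theta> - 1 is where \<theta> < pi/6 enters.\<close>
    have "cos (2 * \<theta>) > cos (pi / 3)"
      using assms(6,7) by (intro cos_monotone_0_pi) auto
    thus "0 < 4 * (cos \<theta>)\<^sup>2 - 3" unfolding dbl by (simp add: cos_60)
    have lam: "lam = 4 * cos \<theta> ^ 3 - 3 * cos \<theta>"
      using assms(8) by (simp add: cos_treble_cos)
    \<comment> \<open>For x = 4 cos^2 \<theta> - 3 the product x^2 (x + 3) is 4 cos^2 (3\<theta>),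
      by the triple-angle formula.\<close>
    show "dn3_cubic lam (4 * (cos \<theta>)\<^sup>2 - 3) = 0"
      unfolding dn3_cubic_def lam by (simp add: algebra_simps power2_eq_square power3_eq_cube)
  qed
  ultimately show ?thesis using x unfolding H_def by blast
qed

end
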